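(* Let $X\in\{\mathbf{S}^2\times\mathbf{R},\ \mathbf{H}^2\times\mathbf{R}\}$ and let $A_0A_1A_2$ be a geodesic triangle of general type in $X$ with surface $\mathcal{S}^X_{A_0A_1A_2}$. If $T$ is a point not on any side of the triangle such that the connecting curve $A_0T$ and $g^X_{A_1A_2}$ meet in $Q$, the connecting curve $A_1T$ and $g^X_{A_0A_2}$ meet in $R$, and the connecting curve $A_2T$ and $g^X_{A_0A_1}$ meet in $P$, where the curves $A_0T,A_1T,A_2T$ lie in $\mathcal{S}^X_{A_0A_1A_2}$, then $$s_g^X(A_0,P,A_1)\,s_g^X(A_1,Q,A_2)\,s_g^X(A_2,R,A_0)=1.$$
   Context: Models. Points are written in homogeneous coordinates $(1,x,y,z)$ and identified with $(x,y,z)\in\mathbf{R}^3$; $E_0=(1,0,0,0)$ is the centre of the model (the Euclidean origin, not a point of $X$). $\mathbf{S}^2\times\mathbf{R}$ is $\{(x,y,z)\ne(0,0,0)\}$ with the Riemannian metric $ds^2=\frac{dx^2+dy^2+dz^2}{x^2+y^2+z^2}$; in coordinates $x=e^t\cos\phi\cos\theta$, $y=e^t\sin\phi\cos\theta$, $z=e^t\sin\theta$ this is $ds^2=dt^2+\cos^2\theta\,d\phi^2+d\theta^2$. $\mathbf{H}^2\times\mathbf{R}$ is $\{(x,y,z): x>0,\ x^2-y^2-z^2>0\}$ with the Riemannian metric which in coordinates $x=e^t\cosh r$, $y=e^t\sinh r\cos\alpha$, $z=e^t\sinh r\sin\alpha$ is $ds^2=dt^2+dr^2+\sinh^2 r\,d\alpha^2$.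 $d^X(P,Q)$ is the geodesic distance (arc length of the geodesic curve from $P$ to $Q$). $g^X_{PQ}$ denotes the geodesic curve containing $P$ and $Q$. Geodesics and the parameter $v$. The geodesics starting at $(1,1,0,0)$ are, with arc length $\tau$ and parameters $-\pi<u\le\pi$, $-\frac{\pi}{2}\le v\le\frac{\pi}{2}$: for $\mathbf{S}^2\times\mathbf{R}$, $(x,y,z)=e^{\tau\sin v}(\cos(\tau\cos v),\ \sin(\tau\cos v)\cos u,\ \sin(\tau\cos v)\sin u)$; for $\mathbf{H}^2\times\mathbf{R}$, $(x,y,z)=e^{\tau\sin v}(\cosh(\tau\cos v),\ \sinh(\tau\cos v)\cos u,\ \sinh(\tau\cos v)\sin u)$. The parameter $v$ of any other geodesic is that of its image under an orientation preserving isometry of $X$ mapping one of its points to $(1,1,0,0)$; $\cos v$ does not depend on the choices. A geodesic is fibre-like ("fibrum-like") if it is a fibre, i.e. $v=\pm\frac{\pi}{2}$, and non-fibre-like otherwise. Convention: for $X=\mathbf{S}^2\times\mathbf{R}$ all geodesic arcs considered are assumed to be less than or equal to a semicircle. Apollonius surface: $\mathcal{A}\mathcal{S}^X_{P_1P_2}(\lambda)$, $\lambda\in[0,\infty)$, is the set of all $P'\in X$ with $d^X(P_1,P')=\lambda\, d^X(P',P_2)$. Geodesic triangle: three points $A_0,A_1,A_2$ (vertices) with the geodesic segments joining them (sides). Surface of a geodesic triangle: for $\lambda_1,\lambda_2\in[0,\infty)$ with $\lambda_1^2+\lambda_2^2>0$ let $\mathcal{C}(\lambda_1,\lambda_2)=\mathcal{A}\mathcal{S}^X_{A_0A_1}(\lambda_1)\cap\mathcal{A}\mathcal{S}^X_{A_2A_0}(\lambda_2)$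 if $\lambda_1,\lambda_2>0$, with $\mathcal{C}(\lambda_1,\lambda_2)=\{A_0\}$ if $\lambda_1=0$ and $\{A_2\}$ if $\lambda_2=0$. Let $P^X(\lambda_1,\lambda_2)=\{P\in\mathcal{C}(\lambda_1,\lambda_2): d^X(P,A_0)=\min_{Q\in\mathcal{C}(\lambda_1,\lambda_2)}d^X(Q,A_0)\}$. The surface $\mathcal{S}^X_{A_0A_1A_2}$ is the union of the $P^X(\lambda_1,\lambda_2)$ over all such $\lambda_1,\lambda_2$. The triangle is of fibre type if its surface lies in a Euclidean plane through $E_0$; otherwise it is of general type (in general location). Connecting curves: for a triangle of general type and $P_1,P_2\in\mathcal{S}^X_{A_0A_1A_2}$, the connecting curve $P_1P_2$ is the image of the geodesic curve $g^X_{P_1P_2}$ in $\mathcal{S}^X_{A_0A_1A_2}$ under central projection with centre $E_0$. Simply ratio: for distinct points $A,B,P$ on a non-fibre-like geodesic curve of $X$ with parameter $v$, $s_g^X(A,P,B)=w^X(d^X(A,P)\cos v)/w^X(d^X(P,B)\cos v)$ if $P$ is between $A$ and $B$, and $s_g^X(A,P,B)=-w^X(d^X(A,P)\cos v)/w^X(d^X(P,B)\cos v)$ otherwise, where $w^X=\sin$ if $X=\mathbf{S}^2\times\mathbf{R}$ and $w^X=\sinh$ if $X=\mathbf{H}^2\times\mathbf{R}$.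
   Formalization: "Meet in" a point is taken to exclude curves overlapping along an arc (otherwise P, Q, R could be arbitrary); the ratios must be defined, and in S²×R the three points of each ratio must lie on one common arc of the side's geodesic of at most a semicircle. *)

theory Defs
  imports "HOL-Analysis.Analysis"
begin

text \<open>
  The point $(1,x,y,z)$ of the projective model is represented by \<open>vector [x, y, z] :: real^3\<close>;
  the centre $E_0$ is \<open>0\<close>.
\<close>

datatype model = S2R | H2R

fun points :: "model \<Rightarrow> (real^3) set" where
  "points S2R = {p. p \<noteq> 0}"
| "points H2R = {p. p$1 > 0 \<and> (p$1)\<^sup>2 - (p$2)\<^sup>2 - (p$3)\<^sup>2 > 0}"

text \<open>
  The metrics are given as quadratic forms on the tangent vectors at a point. For
  $\mathbf{H}^2\times\mathbf{R}$ put $B(p,q) = p_1q_1 - p_2q_2 - p_3q_3$. Then $B(p,p) = e^{2t}$ and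
  $dt = B(p,dp)/B(p,p)$, while $B(dp,dp) = e^{2t}(dt^2 - dr^2 - \sinh^2 r\,d\alpha^2)$. Hence the
  coordinate expression $dt^2 + dr^2 + \sinh^2 r\,d\alpha^2$ equals
  $2\,dt^2 - B(dp,dp)/B(p,p)$; see \<open>ds2_H2R_coordinates\<close>.
\<close>

definition mink :: "real^3 \<Rightarrow> real^3 \<Rightarrow> real" where
  "mink p q = p$1 * q$1 - p$2 * q$2 - p$3 * q$3"

fun ds2 :: "model \<Rightarrow> real^3 \<Rightarrow> real^3 \<Rightarrow> real" where
  "ds2 S2R p u = (u \<bullet> u) / (p \<bullet> p)"
| "ds2 H2R p u = 2 * (mink p u / mink p p)\<^sup>2 - mink u u / mink p p"

definition chart_S2R :: "real \<Rightarrow> real \<Rightarrow> real \<Rightarrow> real^3" where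
  "chart_S2R t \<phi> \<theta> = exp t *\<^sub>R vector [cos \<phi> * cos \<theta>, sin \<phi> * cos \<theta>, sin \<theta>]"

definition chart_H2R :: "real \<Rightarrow> real \<Rightarrow> real \<Rightarrow> real^3" where
  "chart_H2R t r \<alpha> = exp t *\<^sub>R vector [cosh r, sinh r * cos \<alpha>, sinh r * sin \<alpha>]"

lemma has_vector_derivative_vector3:
  fixes f g h :: "real \<Rightarrow> real"
  assumes "(f has_real_derivative f') (at s)" "(g has_real_derivative g') (at s)"
    "(h has_real_derivative h') (at s)"
  shows "((\<lambda>x. vector [f x, g x, h x] :: real^3) has_vector_derivative vector [f', g', h']) (at s)"
proof -
  have eq: "(vector [a, b, c] :: real^3) = a *\<^sub>R axis 1 1 + b *\<^sub>R axis 2 1 + c *\<^sub>R axis 3 1"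
    for a b c :: real
    by (auto simp: vec_eq_iff forall_3 vector_3 axis_def)
  show ?thesis
    unfolding eq using assms
    by (auto intro!: derivative_eq_intros
        simp: has_real_derivative_iff_has_vector_derivative[symmetric])
qed

lemma ds2_S2R_coordinates:
  assumes [derivative_intros]: "(t has_real_derivative t') (at s)"
    "(\<phi> has_real_derivative \<phi>') (at s)" "(\<theta> has_real_derivative \<theta>') (at s)"
  shows "\<exists>V. ((\<lambda>x. chart_S2R (t x) (\<phi> x) (\<theta> x)) has_vector_derivative V) (at s) \<and>
    ds2 S2R (chart_S2R (t s) (\<phi> s) (\<theta> s)) V = t'\<^sup>2 + (cos (\<theta> s))\<^sup>2 * \<phi>'\<^sup>2 + \<theta>'\<^sup>2"
proof -
  define e c d C D where "e = exp (t s)" and "c = cos (\<theta> s)" and "d = sin (\<theta> s)"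
    and "C = cos (\<phi> s)" and "D = sin (\<phi> s)"
  have e: "e > 0" and cd: "c\<^sup>2 + d\<^sup>2 = 1" and CD: "C\<^sup>2 + D\<^sup>2 = 1"
    by (auto simp: e_def c_def d_def C_def D_def)
  define p V :: "real^3" where "p = chart_S2R (t s) (\<phi> s) (\<theta> s)" and
    "V = vector [e*t'*C*c - e*D*\<phi>'*c - e*C*d*\<theta>', e*t'*D*c + e*C*\<phi>'*c - e*D*d*\<theta>',
                 e*t'*d + e*c*\<theta>']"
  have scale: "chart_S2R x y z = vector [exp x * (cos y * cos z), exp x * (sin y * cos z), exp x * sin z]"
    for x y z
    by (auto simp: chart_S2R_def vec_eq_iff forall_3 vector_3)
  have "((\<lambda>x. chart_S2R (t x) (\<phi> x) (\<theta> x)) has_vector_derivative V) (at s)"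
    unfolding scale V_def e_def c_def d_def C_def D_def
    by (rule has_vector_derivative_vector3)
       (auto intro!: derivative_eq_intros simp: algebra_simps)
  moreover have "p \<bullet> p = e\<^sup>2"
    unfolding p_def scale e_def[symmetric] c_def[symmetric] d_def[symmetric] C_def[symmetric]
      D_def[symmetric]
    using cd CD by (simp add: vector_3 inner_vec_def sum_3) algebra
  moreover have "V \<bullet> V = e\<^sup>2 * (t'\<^sup>2 + c\<^sup>2 * \<phi>'\<^sup>2 + \<theta>'\<^sup>2)"
    unfolding V_def using cd CD by (simp add: vector_3 inner_vec_def sum_3) algebra
  ultimately show ?thesis
    using e by (intro exI[of _ V]) (simp add: p_def[symmetric] c_def)
qed

lemma ds2_H2R_coordinates:
  assumes [derivative_intros]: "(t has_real_derivative t') (at s)"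
    "(r has_real_derivative r') (at s)" "(\<alpha> has_real_derivative \<alpha>') (at s)"
  shows "\<exists>V. ((\<lambda>x. chart_H2R (t x) (r x) (\<alpha> x)) has_vector_derivative V) (at s) \<and>
    ds2 H2R (chart_H2R (t s) (r s) (\<alpha> s)) V = t'\<^sup>2 + r'\<^sup>2 + (sinh (r s))\<^sup>2 * \<alpha>'\<^sup>2"
proof -
  define e c d C D where "e = exp (t s)" and "c = cosh (r s)" and "d = sinh (r s)"
    and "C = cos (\<alpha> s)" and "D = sin (\<alpha> s)"
  have e: "e > 0" and cd: "c\<^sup>2 = 1 + d\<^sup>2" and CD: "C\<^sup>2 + D\<^sup>2 = 1"
    by (auto simp: e_def c_def d_def C_def D_def cosh_square_eq)
  define p V :: "real^3" where "p = chart_H2R (t s) (r s) (\<alpha> s)" and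
    "V = vector [e*t'*c + e*d*r', e*t'*d*C + e*c*r'*C - e*d*D*\<alpha>',
                 e*t'*d*D + e*c*r'*D + e*d*C*\<alpha>']"
  have scale: "chart_H2R x y z = vector [exp x * cosh y, exp x * (sinh y * cos z), exp x * (sinh y * sin z)]"
    for x y z
    by (auto simp: chart_H2R_def vec_eq_iff forall_3 vector_3)
  have "((\<lambda>x. chart_H2R (t x) (r x) (\<alpha> x)) has_vector_derivative V) (at s)"
    unfolding scale V_def e_def c_def d_def C_def D_def
    by (rule has_vector_derivative_vector3)
       (auto intro!: derivative_eq_intros simp: algebra_simps)
  moreover have p: "p = vector [e * c, e * (d * C), e * (d * D)]"
    unfolding p_def scale by (simp add: e_def c_def d_def C_def D_def)
  have "mink p p = e\<^sup>2"
    unfolding p mink_def using cd CD by (simp add: vector_3) algebra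
  moreover have "mink p V = e\<^sup>2 * t'"
    unfolding p V_def mink_def using cd CD by (simp add: vector_3) algebra
  moreover have "mink V V = e\<^sup>2 * (t'\<^sup>2 - r'\<^sup>2 - d\<^sup>2 * \<alpha>'\<^sup>2)"
    unfolding V_def mink_def using cd CD by (simp add: vector_3) algebra
  ultimately show ?thesis
    using e by (intro exI[of _ V]) (simp add: p_def[symmetric] d_def)
qed

definition orientation_preserving_isometry :: "model \<Rightarrow> (real^3 \<Rightarrow> real^3) \<Rightarrow> bool" where
  "orientation_preserving_isometry X f \<longleftrightarrow> bij_betw f (points X) (points X) \<and>
    (\<exists>D. (\<forall>p\<in>points X. (f has_derivative D p) (at p) \<and> det (matrix (D p)) > 0 \<and>
              (\<forall>u. ds2 X (f p) (D p u) = ds2 X p u)) \<and>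
         (\<forall>u. continuous_on (points X) (\<lambda>p. D p u)))"

text \<open>The geodesics starting at $(1,1,0,0)$, parametrised by arc length.\<close>

fun base_geodesic :: "model \<Rightarrow> real \<Rightarrow> real \<Rightarrow> real \<Rightarrow> real^3" where
  "base_geodesic S2R u v \<tau> = exp (\<tau> * sin v) *\<^sub>R
     vector [cos (\<tau> * cos v), sin (\<tau> * cos v) * cos u, sin (\<tau> * cos v) * sin u]"
| "base_geodesic H2R u v \<tau> = exp (\<tau> * sin v) *\<^sub>R
     vector [cosh (\<tau> * cos v), sinh (\<tau> * cos v) * cos u, sinh (\<tau> * cos v) * sin u]"

definition has_param :: "model \<Rightarrow> (real \<Rightarrow> real^3) \<Rightarrow> real \<Rightarrow> bool" where
  "has_param X \<gamma> v \<longleftrightarrow> - (pi/2) \<le> v \<and> v \<le> pi/2 \<and>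
    (\<exists>f u. orientation_preserving_isometry X f \<and> - pi < u \<and> u \<le> pi \<and>
           (\<forall>\<tau>. \<gamma> \<tau> = f (base_geodesic X u v \<tau>)))"

definition geodesic :: "model \<Rightarrow> (real \<Rightarrow> real^3) \<Rightarrow> bool" where
  "geodesic X \<gamma> \<longleftrightarrow> (\<exists>v. has_param X \<gamma> v)"

text \<open>The parameter depends on the choice of the isometry, but its cosine does not.\<close>

definition v_param :: "model \<Rightarrow> (real \<Rightarrow> real^3) \<Rightarrow> real" where
  "v_param X \<gamma> = (SOME v. has_param X \<gamma> v)"

definition fibre_like :: "model \<Rightarrow> (real \<Rightarrow> real^3) \<Rightarrow> bool" where
  "fibre_like X \<gamma> \<longleftrightarrow> \<bar>v_param X \<gamma>\<bar> = pi/2"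

text \<open>Two points may be joined by several geodesic arcs in $\mathbf{S}^2\times\mathbf{R}$; the
  distance is the length of a shortest one.\<close>

definition gdist :: "model \<Rightarrow> real^3 \<Rightarrow> real^3 \<Rightarrow> real" where
  "gdist X P Q = Inf {\<tau>. 0 \<le> \<tau> \<and> (\<exists>\<gamma>. geodesic X \<gamma> \<and> \<gamma> 0 = P \<and> \<gamma> \<tau> = Q)}"

text \<open>An arc of length \<open>l\<close> on \<open>\<gamma>\<close> projects onto a great circle arc of length
  \<open>l * cos v\<close>; it is admitted only if that is at most a semicircle.\<close>

definition admissible_arc :: "model \<Rightarrow> (real \<Rightarrow> real^3) \<Rightarrow> real \<Rightarrow> bool" where
  "admissible_arc X \<gamma> l \<longleftrightarrow> (X = S2R \<longrightarrow> \<bar>l\<bar> * cos (v_param X \<gamma>) \<le> pi)"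

text \<open>\<open>joins X \<gamma> A B\<close>: the complete geodesic curve \<open>range \<gamma>\<close> is $g^X_{AB}$, parametrised by the
  oriented arc length from \<open>A\<close>. A relation is used because in $\mathbf{S}^2\times\mathbf{R}$ points over
  antipodal points of the sphere have more than one such curve.\<close>

definition joins :: "model \<Rightarrow> (real \<Rightarrow> real^3) \<Rightarrow> real^3 \<Rightarrow> real^3 \<Rightarrow> bool" where
  "joins X \<gamma> A B \<longleftrightarrow> geodesic X \<gamma> \<and> \<gamma> 0 = A \<and> (\<exists>l\<ge>0. \<gamma> l = B \<and> admissible_arc X \<gamma> l)"

definition geodesic_segment :: "model \<Rightarrow> (real \<Rightarrow> real^3) \<Rightarrow> real^3 \<Rightarrow> (real^3) set" where
  "geodesic_segment X \<gamma> B = {\<gamma> s |s l. 0 \<le> s \<and> s \<le> l \<and> \<gamma> l = B \<and> admissible_arc X \<gamma> l}"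

definition apollonius :: "model \<Rightarrow> real^3 \<Rightarrow> real^3 \<Rightarrow> real \<Rightarrow> (real^3) set" where
  "apollonius X P1 P2 \<mu> = {P \<in> points X. gdist X P1 P = \<mu> * gdist X P P2}"

definition apollonius_curve ::
  "model \<Rightarrow> real^3 \<Rightarrow> real^3 \<Rightarrow> real^3 \<Rightarrow> real \<Rightarrow> real \<Rightarrow> (real^3) set" where
  "apollonius_curve X A0 A1 A2 \<mu>1 \<mu>2 =
    (if \<mu>1 = 0 then {A0} else if \<mu>2 = 0 then {A2}
     else apollonius X A0 A1 \<mu>1 \<inter> apollonius X A2 A0 \<mu>2)"

definition nearest_points ::
  "model \<Rightarrow> real^3 \<Rightarrow> real^3 \<Rightarrow> real^3 \<Rightarrow> real \<Rightarrow> real \<Rightarrow> (real^3) set" where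
  "nearest_points X A0 A1 A2 \<mu>1 \<mu>2 =
    {P \<in> apollonius_curve X A0 A1 A2 \<mu>1 \<mu>2.
       \<forall>Q \<in> apollonius_curve X A0 A1 A2 \<mu>1 \<mu>2. gdist X P A0 \<le> gdist X Q A0}"

definition triangle_surface :: "model \<Rightarrow> real^3 \<Rightarrow> real^3 \<Rightarrow> real^3 \<Rightarrow> (real^3) set" where
  "triangle_surface X A0 A1 A2 =
    (\<Union>(\<mu>1, \<mu>2) \<in> {(\<mu>1, \<mu>2). 0 \<le> \<mu>1 \<and> 0 \<le> \<mu>2 \<and> \<mu>1\<^sup>2 + \<mu>2\<^sup>2 > 0}.
       nearest_points X A0 A1 A2 \<mu>1 \<mu>2)"

definition fibre_type :: "model \<Rightarrow> real^3 \<Rightarrow> real^3 \<Rightarrow> real^3 \<Rightarrow> bool" where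
  "fibre_type X A0 A1 A2 \<longleftrightarrow> (\<exists>n. n \<noteq> 0 \<and> (\<forall>P \<in> triangle_surface X A0 A1 A2. n \<bullet> P = 0))"

abbreviation general_type :: "model \<Rightarrow> real^3 \<Rightarrow> real^3 \<Rightarrow> real^3 \<Rightarrow> bool" where
  "general_type X A0 A1 A2 \<equiv> \<not> fibre_type X A0 A1 A2"

text \<open>The projection is along the rays from $E_0$, i.e. along the fibres of \<open>X\<close>.\<close>

definition central_projection :: "(real^3) set \<Rightarrow> (real^3) set \<Rightarrow> (real^3) set" where
  "central_projection S G = {P \<in> S. \<exists>Z\<in>G. \<exists>c>0. P = c *\<^sub>R Z}"

text \<open>Two curves meeting in a point is understood to exclude that they
  overlap along an arc; several common points are allowed.\<close>

definition meet_in :: "(real^3) set \<Rightarrow> (real^3) set \<Rightarrow> real^3 \<Rightarrow> bool" where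
  "meet_in C G Q \<longleftrightarrow> Q \<in> C \<inter> G \<and> (\<nexists>c. arc c \<and> path_image c \<subseteq> C \<inter> G)"

fun w :: "model \<Rightarrow> real \<Rightarrow> real" where
  "w S2R x = sin x"
| "w H2R x = sinh x"

text \<open>
  The simply ratio of \<open>A = \<gamma> 0\<close>, \<open>P\<close>, \<open>B\<close> for \<open>joins X \<gamma> A B\<close>, and the conditions under which it
  is defined. The arcs $AB$, $AP$, $PB$ are taken along \<open>\<gamma>\<close>. The denominator can vanish only in
  $\mathbf{S}^2\times\mathbf{R}$, when the arc $PB$ is a semicircle.
\<close>

definition simply_ratio ::
  "model \<Rightarrow> (real \<Rightarrow> real^3) \<Rightarrow> real^3 \<Rightarrow> real^3 \<Rightarrow> real^3 \<Rightarrow> real" where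
  "simply_ratio X \<gamma> A P B =
    (let q = w X (gdist X A P * cos (v_param X \<gamma>)) / w X (gdist X P B * cos (v_param X \<gamma>))
     in if P \<in> geodesic_segment X \<gamma> B then q else - q)"

definition ratio_defined ::
  "model \<Rightarrow> (real \<Rightarrow> real^3) \<Rightarrow> real^3 \<Rightarrow> real^3 \<Rightarrow> real^3 \<Rightarrow> bool" where
  "ratio_defined X \<gamma> A P B \<longleftrightarrow>
    \<not> fibre_like X \<gamma> \<and> A \<noteq> B \<and> A \<noteq> P \<and> P \<noteq> B \<and>
    (\<exists>l\<ge>0. \<exists>p. \<gamma> l = B \<and> \<gamma> p = P \<and>
       admissible_arc X \<gamma> l \<and> admissible_arc X \<gamma> p \<and> admissible_arc X \<gamma> (p - l)) \<and>
    w X (gdist X P B * cos (v_param X \<gamma>)) \<noteq> 0"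

end

theory Submission
  imports Defs
begin

text \<open>
  Radial projection sends the problem to the sphere or the hyperbolic plane. Isometries preserve
  the product distance, and a parallelogram identity characterises the fibres, so isometries
  permute the fibres; hence every geodesic is $e^{c+st}(C(kt)a + S(kt)b)$ with $a$, $b$ orthonormal
  for the Euclidean or Lorentzian form and $k = \cos v$, and the simply ratio of $A$, $P$, $B$ is
  the number $\sigma$ for which $P$ is parallel to $a + \sigma b$, where $a$, $b$ are the normalised
  $A$, $B$. Putting $t_0 = T \cdot (a_1 \times a_2)$, and $t_1$, $t_2$ cyclically, the three cevians give
  $t_1 = \sigma_0 t_0$, $t_2 = \sigma_1 t_1$, $t_0 = \sigma_2 t_2$, whence the product is $1$ unless all
  $t_i$ vanish. In that case $T$ and the vertices lie in a plane through $E_0$. The sides $A_0A_1$ and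
  $A_2A_0$ belong to the surface by minimality of distance, so that one of them overlaps with the
  projection of a cevian along an arc, against the meaning of ``meet''.
\<close>

section \<open>Lorentzian and Euclidean forms, and the product distance\<close>

text \<open>Geodesics are images of model curves under isometries known only through their
  derivatives, while \<open>gdist\<close> is an infimum over such images and \<open>v_param\<close>
  an arbitrary choice. The explicit \<open>rho\<close> answers both difficulties: isometries
  preserve it, which determines them well enough, and it turns out to equal \<open>gdist\<close>.
  Preservation needs no integral of arc length: a first-order bound and bisection show that a curve
  of constant speed is not shorter than its chord. Fibres are recognised because shifting a point by
  s up and down the flat factor gives a median identity with every other point, and the curvature of
  the base forbids this for a displacement in the base. The cevian relations are homogeneous in T,
  so they say nothing when all t_i vanish. The surface is built from the pairs A0, A1 and A2, A0
  only, and only these two sides are shown to lie in it; hence the degenerate case is settled by the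
  cevians from A1 and A2.\<close>

definition bil :: "model \<Rightarrow> real^3 \<Rightarrow> real^3 \<Rightarrow> real" where
  "bil X x y = (case X of S2R \<Rightarrow> x \<bullet> y | H2R \<Rightarrow> mink x y)"

text \<open>This is the curvature of the base, the sphere or the hyperbolic plane. It lets both
  models share one set of formulas.\<close>

definition eps :: "model \<Rightarrow> real" where
  "eps X = (case X of S2R \<Rightarrow> 1 | H2R \<Rightarrow> -1)"

definition cosX :: "model \<Rightarrow> real \<Rightarrow> real" where
  "cosX X t = (case X of S2R \<Rightarrow> cos t | H2R \<Rightarrow> cosh t)"

definition unit :: "model \<Rightarrow> real^3 \<Rightarrow> real^3" where
  "unit X x = x /\<^sub>R sqrt (bil X x x)"

text \<open>This is the coordinate t of the charts, since \<open>bil X x x\<close> equals e to the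
  power 2t.\<close>

definition height :: "model \<Rightarrow> real^3 \<Rightarrow> real" where
  "height X x = ln (bil X x x) / 2"

definition ang :: "model \<Rightarrow> real^3 \<Rightarrow> real^3 \<Rightarrow> real" where
  "ang X x y = (let m = bil X (unit X x) (unit X y)
     in case X of S2R \<Rightarrow> arccos m | H2R \<Rightarrow> arcosh m)"

definition rho :: "model \<Rightarrow> real^3 \<Rightarrow> real^3 \<Rightarrow> real" where
  "rho X x y = sqrt ((height X x - height X y)\<^sup>2 + (ang X x y)\<^sup>2)"

definition unit_points :: "model \<Rightarrow> (real^3) set" where
  "unit_points X = {x \<in> points X. bil X x x = 1}"

lemma eps_square [simp]: "eps X * eps X = 1" "(eps X)\<^sup>2 = 1"
  by (cases X; simp add: eps_def)+

lemma bil_commute: "bil X x y = bil X y x"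
  by (cases X) (simp_all add: bil_def mink_def inner_commute mult.commute)

lemma bil_simps [simp]:
  "bil X (x + y) z = bil X x z + bil X y z" "bil X z (x + y) = bil X z x + bil X z y"
  "bil X (x - y) z = bil X x z - bil X y z" "bil X z (x - y) = bil X z x - bil X z y"
  "bil X (c *\<^sub>R x) z = c * bil X x z" "bil X z (c *\<^sub>R x) = c * bil X z x"
  "bil X (- x) z = - bil X x z" "bil X z (- x) = - bil X z x"
  "bil X 0 z = 0" "bil X z 0 = 0"
  by (cases X; simp add: bil_def mink_def algebra_simps inner_simps)+

text \<open>A Gram determinant is the squared volume times the determinant of the form, and both
  forms have determinant 1. The sign is therefore the same in both models, which gives
  \<open>ang_triangle\<close> a common proof.\<close>

lemma bil_gram:
  "bil X x x * bil X y y * bil X z z + 2 * bil X x y * bil X y z * bil X x z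
   - bil X x x * (bil X y z)\<^sup>2 - bil X y y * (bil X x z)\<^sup>2 - bil X z z * (bil X x y)\<^sup>2
   = (x \<bullet> cross3 y z)\<^sup>2"
  by (cases X) (simp_all add: bil_def mink_def cross3_def inner_vec_def sum_3 power2_eq_square algebra_simps)

lemma cosX_w_square: "(cosX X t)\<^sup>2 + eps X * (w X t)\<^sup>2 = 1"
  by (cases X) (simp_all add: cosX_def eps_def cosh_square_eq)

lemma w_minus [simp]: "w X (- t) = - w X t" and w_0 [simp]: "w X 0 = 0"
  by (cases X; simp)+

lemma cosX_minus [simp]: "cosX X (- t) = cosX X t" and cosX_0 [simp]: "cosX X 0 = 1"
  by (cases X; simp add: cosX_def)+

lemma w_diff: "w X (s - t) = w X s * cosX X t - cosX X s * w X t"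
  by (cases X) (simp_all add: cosX_def sin_diff sinh_diff)

lemma cosX_diff: "cosX X (s - t) = cosX X s * cosX X t + eps X * (w X s * w X t)"
  by (cases X) (simp_all add: cosX_def eps_def cos_diff cosh_diff)

lemma cosX_abs [simp]: "cosX X \<bar>t\<bar> = cosX X t"
  by (cases X) (simp_all add: cosX_def abs_if)

lemma points_nonzero: "x \<in> points X \<Longrightarrow> x \<noteq> 0"
  by (cases X) auto

lemma bil_pos: "x \<in> points X \<Longrightarrow> bil X x x > 0"
  by (cases X) (auto simp: bil_def mink_def power2_eq_square)

lemma points_scale: "x \<in> points X \<Longrightarrow> c > 0 \<Longrightarrow> c *\<^sub>R x \<in> points X"
proof (cases X)
  case H2R
  assume x: "x \<in> points X" and c: "c > 0"
  have "(c * x$1)\<^sup>2 - (c * x$2)\<^sup>2 - (c * x$3)\<^sup>2 = c\<^sup>2 * ((x$1)\<^sup>2 - (x$2)\<^sup>2 - (x$3)\<^sup>2)"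
    by algebra
  also have "\<dots> > 0" using x c H2R by simp
  finally show ?thesis using x c H2R by simp
qed auto

lemma open_points: "open (points X)"
proof (cases X)
  case H2R
  have "points H2R = {p. 0 < p$1} \<inter> {p. 0 < (p$1)\<^sup>2 - (p$2)\<^sup>2 - (p$3)\<^sup>2}" by auto
  moreover have "open \<dots>"
    by (intro open_Int open_Collect_less continuous_intros)
  ultimately show ?thesis using H2R by simp
next
  case S2R
  have "points S2R = - {0}" by auto
  then show ?thesis using S2R by (simp add: open_Compl)
qed

section \<open>The reversed Cauchy-Schwarz inequality inside the light cone\<close>

lemma bil_H2R_lagrange:
  "(bil H2R x y)\<^sup>2 - bil H2R x x * bil H2R y y
   = (x$1 * y$2 - x$2 * y$1)\<^sup>2 + (x$1 * y$3 - x$3 * y$1)\<^sup>2 - (x$2 * y$3 - x$3 * y$2)\<^sup>2"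
  by (simp add: bil_def mink_def) algebra

text \<open>With d, e as below and f the third minor, x1 f = x2 e - x3 d. Eliminating f leaves a
  perfect square as the difference of the two sides. The quantitative form also yields the equality
  case and the positivity of \<open>ds2\<close>.\<close>

lemma bil_H2R_lagrange_ge:
  "((x$1)\<^sup>2 - (x$2)\<^sup>2 - (x$3)\<^sup>2)
      * ((x$1 * y$2 - x$2 * y$1)\<^sup>2 + (x$1 * y$3 - x$3 * y$1)\<^sup>2)
    \<le> (x$1)\<^sup>2 * ((bil H2R x y)\<^sup>2 - bil H2R x x * bil H2R y y)"
proof -
  define d e where "d = x$1 * y$2 - x$2 * y$1" and "e = x$1 * y$3 - x$3 * y$1"
  have "(x$1)\<^sup>2 * (d\<^sup>2 + e\<^sup>2 - (x$2 * y$3 - x$3 * y$2)\<^sup>2)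
      - ((x$1)\<^sup>2 - (x$2)\<^sup>2 - (x$3)\<^sup>2) * (d\<^sup>2 + e\<^sup>2) = (x$2 * d + x$3 * e)\<^sup>2"
    unfolding d_def e_def by algebra
  then show ?thesis
    unfolding bil_H2R_lagrange d_def[symmetric] e_def[symmetric]
    by (metis diff_ge_0_iff_ge zero_le_power2)
qed

lemma points_H2R_gram:
  assumes x: "x \<in> points H2R" and y: "y \<in> points H2R"
  shows "bil H2R x x * bil H2R y y \<le> (bil H2R x y)\<^sup>2"
    and "bil H2R x x * bil H2R y y = (bil H2R x y)\<^sup>2 \<Longrightarrow> cross3 x y = 0"
    and "bil H2R x y > 0"
proof -
  define d e where "d = x$1 * y$2 - x$2 * y$1" and "e = x$1 * y$3 - x$3 * y$1"
  have x1: "x$1 > 0" and xq: "(x$2)\<^sup>2 + (x$3)\<^sup>2 < (x$1)\<^sup>2" using x by auto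
  have y1: "y$1 > 0" and yq: "(y$2)\<^sup>2 + (y$3)\<^sup>2 < (y$1)\<^sup>2" using y by auto
  define D where "D = (bil H2R x y)\<^sup>2 - bil H2R x x * bil H2R y y"
  have D2: "((x$1)\<^sup>2 - (x$2)\<^sup>2 - (x$3)\<^sup>2) * (d\<^sup>2 + e\<^sup>2) \<le> (x$1)\<^sup>2 * D"
    unfolding D_def d_def e_def by (rule bil_H2R_lagrange_ge)
  have pos: "(x$1)\<^sup>2 - (x$2)\<^sup>2 - (x$3)\<^sup>2 > 0" using xq by simp
  then have "(x$1)\<^sup>2 * D \<ge> 0" using D2
    by (smt (verit) mult_nonneg_nonneg sum_power2_ge_zero)
  then have D0: "D \<ge> 0" using x1 by (simp add: zero_le_mult_iff)
  then show "bil H2R x x * bil H2R y y \<le> (bil H2R x y)\<^sup>2" by (simp add: D_def)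
  { assume "bil H2R x x * bil H2R y y = (bil H2R x y)\<^sup>2"
    then have "D = 0" by (simp add: D_def)
    then have "((x$1)\<^sup>2 - (x$2)\<^sup>2 - (x$3)\<^sup>2) * (d\<^sup>2 + e\<^sup>2) \<le> 0" using D2 by simp
    then have "d\<^sup>2 + e\<^sup>2 \<le> 0" using pos by (simp add: mult_le_0_iff)
    then have "d = 0" "e = 0" by (simp_all add: sum_power2_le_zero_iff)
    moreover have "x$1 * (x$2 * y$3 - x$3 * y$2) = x$2 * e - x$3 * d"
      unfolding d_def e_def by algebra
    ultimately have "d = 0" "e = 0" "x$2 * y$3 - x$3 * y$2 = 0" using x1 by simp_all
    then show "cross3 x y = 0"
      unfolding d_def e_def by (simp add: cross3_def vec_eq_iff forall_3 algebra_simps) }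
  have "(x$2 * y$2 + x$3 * y$3)\<^sup>2 \<le> ((x$2)\<^sup>2 + (x$3)\<^sup>2) * ((y$2)\<^sup>2 + (y$3)\<^sup>2)"
  proof -
    have "((x$2)\<^sup>2 + (x$3)\<^sup>2) * ((y$2)\<^sup>2 + (y$3)\<^sup>2) - (x$2 * y$2 + x$3 * y$3)\<^sup>2
        = (x$2 * y$3 - x$3 * y$2)\<^sup>2" by algebra
    then show ?thesis by (metis diff_ge_0_iff_ge zero_le_power2)
  qed
  also have "\<dots> < (x$1)\<^sup>2 * (y$1)\<^sup>2"
    using xq yq by (intro mult_strict_mono') auto
  finally have "(x$2 * y$2 + x$3 * y$3)\<^sup>2 < (x$1 * y$1)\<^sup>2" by (simp add: power_mult_distrib)
  then have "\<bar>x$2 * y$2 + x$3 * y$3\<bar> < x$1 * y$1"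
    using x1 y1 by (metis abs_of_pos mult_pos_pos power2_less_imp_less power2_abs less_imp_le)
  then show "bil H2R x y > 0" by (simp add: bil_def mink_def)
qed

text \<open>The factor \<open>eps X\<close> merges the usual inequality with the reversed one of the
  Lorentzian form.\<close>

lemma bil_cauchy_schwarz:
  assumes "x \<in> points X" "y \<in> points X"
  shows "0 \<le> eps X * (bil X x x * bil X y y - (bil X x y)\<^sup>2)"
  using assms points_H2R_gram(1) by (cases X) (auto simp: eps_def bil_def Cauchy_Schwarz_ineq)

lemma bil_cauchy_schwarz_eq:
  assumes "x \<in> points X" "y \<in> points X" "bil X x x * bil X y y = (bil X x y)\<^sup>2"
  shows "cross3 x y = 0"
proof (cases X)
  case S2R
  have "norm (cross3 x y) ^ 2 + (x \<bullet> y)\<^sup>2 = (x \<bullet> x) * (y \<bullet> y)"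
    using norm_cross_dot[of x y] by (simp add: power_mult_distrib power2_norm_eq_inner)
  then show ?thesis using assms(3) S2R by (simp add: bil_def)
next
  case H2R
  then show ?thesis using points_H2R_gram(2) assms by blast
qed

lemma unit_points_subset: "x \<in> unit_points X \<Longrightarrow> x \<in> points X"
  by (simp add: unit_points_def)

lemma unit_in_unit_points:
  assumes "x \<in> points X"
  shows "unit X x \<in> unit_points X"
proof -
  define r where "r = sqrt (bil X x x)"
  have r: "r > 0" using bil_pos[OF assms] by (simp add: r_def)
  have q: "bil X x x = r * r" using bil_pos[OF assms] by (simp add: r_def)
  have u: "unit X x = inverse r *\<^sub>R x" by (simp add: unit_def r_def)
  have "bil X (unit X x) (unit X x) = 1"
    unfolding u using r by (simp add: q field_simps)
  moreover have "unit X x \<in> points X"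
    unfolding u using r assms by (intro points_scale) auto
  ultimately show ?thesis by (simp add: unit_points_def)
qed

lemma unit_scale: "x \<in> points X \<Longrightarrow> c > 0 \<Longrightarrow> unit X (c *\<^sub>R x) = unit X x"
  using bil_pos[of x X] by (simp add: unit_def real_sqrt_mult field_simps)

lemma unit_unit_points [simp]: "x \<in> unit_points X \<Longrightarrow> unit X x = x"
  by (simp add: unit_def unit_points_def)

lemma unit_idem [simp]: "x \<in> points X \<Longrightarrow> unit X (unit X x) = unit X x"
  by (simp add: unit_in_unit_points)

lemma scale_unit: "x \<in> points X \<Longrightarrow> x = exp (height X x) *\<^sub>R unit X x"
  using bil_pos[of x X] by (simp add: unit_def height_def flip: ln_sqrt)

lemma height_scale: "x \<in> points X \<Longrightarrow> c > 0 \<Longrightarrow> height X (c *\<^sub>R x) = ln c + height X x"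
  using bil_pos[of x X] by (simp add: height_def ln_mult field_simps)

lemma height_unit_points [simp]: "x \<in> unit_points X \<Longrightarrow> height X x = 0"
  by (simp add: height_def unit_points_def)

lemma cross3_scale [simp]:
  "cross3 (c *\<^sub>R x) y = c *\<^sub>R cross3 x y" "cross3 x (c *\<^sub>R y) = c *\<^sub>R cross3 x y"
  by (simp_all add: cross_mult_left cross_mult_right)

lemma bil_unit: "x \<in> points X \<Longrightarrow> bil X (unit X x) (unit X x) = 1"
  using unit_in_unit_points[of x X] by (simp add: unit_points_def)

lemma bil_unit_bounds:
  assumes "x \<in> points X" "y \<in> points X"
  shows "X = S2R \<Longrightarrow> \<bar>bil X (unit X x) (unit X y)\<bar> \<le> 1"
    and "X = H2R \<Longrightarrow> bil X (unit X x) (unit X y) \<ge> 1"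
proof -
  let ?m = "bil X (unit X x) (unit X y)"
  have u: "unit X x \<in> points X" "unit X y \<in> points X"
    using assms unit_in_unit_points unit_points_subset by blast+
  have *: "0 \<le> eps X * (1 - ?m\<^sup>2)"
    using bil_cauchy_schwarz[OF u] assms by (simp add: bil_unit)
  { assume "X = S2R"
    then show "\<bar>?m\<bar> \<le> 1" using * by (simp add: eps_def abs_square_le_1) }
  { assume X: "X = H2R"
    then have "1 \<le> ?m\<^sup>2" using * by (simp add: eps_def)
    moreover have "?m > 0" using points_H2R_gram(3) u X by blast
    ultimately show "?m \<ge> 1" by (metis less_imp_le one_power2 power2_le_imp_le) }
qed

lemma cosX_ang:
  assumes "x \<in> points X" "y \<in> points X"
  shows "cosX X (ang X x y) = bil X (unit X x) (unit X y)"
  using bil_unit_bounds[OF assms]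
  by (cases X) (auto simp: cosX_def ang_def Let_def)

lemma ang_nonneg:
  assumes "x \<in> points X" "y \<in> points X"
  shows "0 \<le> ang X x y"
  using bil_unit_bounds[OF assms]
  by (cases X) (auto simp: ang_def Let_def intro: arccos_lbound)

lemma ang_le_pi:
  assumes "x \<in> points S2R" "y \<in> points S2R"
  shows "ang S2R x y \<le> pi"
  using bil_unit_bounds[OF assms]
  by (auto simp: ang_def Let_def intro: arccos_ubound)

lemma ang_unique:
  assumes "0 \<le> t" "X = S2R \<Longrightarrow> t \<le> pi" "cosX X t = bil X (unit X x) (unit X y)"
  shows "ang X x y = t"
  using assms(1,2) unfolding ang_def Let_def assms(3)[symmetric]
  by (cases X) (auto simp: cosX_def arccos_cos arcosh_cosh_real)

lemma ang_commute: "ang X x y = ang X y x"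
  by (simp add: ang_def bil_commute)

lemma cross3_unit_zero:
  assumes "x \<in> unit_points X" "y \<in> unit_points X" "cross3 x y = 0"
  shows "y = x \<or> y = - x"
proof -
  have "x \<noteq> 0" using assms points_nonzero unit_points_subset by blast
  moreover have "collinear {0, x, y}" using assms(3) cross_eq_0 by blast
  ultimately obtain c where c: "y = c *\<^sub>R x" by (auto simp: collinear_lemma)
  then have "c\<^sup>2 = 1" using assms(1,2) by (simp add: unit_points_def power2_eq_square)
  then have "c = 1 \<or> c = -1" by (simp add: power2_eq_1_iff)
  then show ?thesis using c by auto
qed

lemma ang_eq_0_iff:
  assumes "x \<in> points X" "y \<in> points X"
  shows "ang X x y = 0 \<longleftrightarrow> unit X x = unit X y"
proof
  assume "ang X x y = 0"
  then have b: "bil X (unit X x) (unit X y) = 1" using cosX_ang[OF assms] by simp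
  have u: "unit X x \<in> unit_points X" "unit X y \<in> unit_points X"
    using assms unit_in_unit_points by blast+
  then have "cross3 (unit X x) (unit X y) = 0"
    using b by (intro bil_cauchy_schwarz_eq[of _ X]) (auto simp: unit_points_def)
  then show "unit X x = unit X y"
    using cross3_unit_zero[OF u] b bil_unit[OF assms(1)] by auto
next
  assume "unit X x = unit X y"
  then have "bil X (unit X x) (unit X y) = 1" using bil_unit[OF assms(2)] by simp
  then show "ang X x y = 0" using ang_unique[of 0 X x y] by simp
qed

text \<open>Nonnegativity of the Gram determinant of the three unit points says that cos c differs
  from cos a cos b by at most |sin a sin b|, with cosh and sinh in the hyperbolic case. The addition
  theorem then compares c with a + b. On the sphere this needs a + b to be at most pi; otherwise c
  is bounded by pi anyway.\<close>

lemma ang_triangle: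
  assumes x: "x \<in> points X" and y: "y \<in> points X" and z: "z \<in> points X"
  shows "ang X x z \<le> ang X x y + ang X y z"
proof -
  define a b c where "a = ang X x y" and "b = ang X y z" and "c = ang X x z"
  have nn: "a \<ge> 0" "b \<ge> 0" "c \<ge> 0" unfolding a_def b_def c_def using assms by (simp_all only: ang_nonneg)
  have "1 + 2 * cosX X a * cosX X b * cosX X c - (cosX X b)\<^sup>2 - (cosX X c)\<^sup>2 - (cosX X a)\<^sup>2 \<ge> 0"
    using bil_gram[of X "unit X x" "unit X y" "unit X z"]
    by (simp add: cosX_ang assms bil_unit a_def b_def c_def)
  then have "(cosX X c - cosX X a * cosX X b)\<^sup>2 \<le> (1 - (cosX X a)\<^sup>2) * (1 - (cosX X b)\<^sup>2)"
    by (simp add: power2_eq_square algebra_simps)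
  also have "\<dots> = (w X a * w X b)\<^sup>2"
  proof -
    have "1 - (cosX X a)\<^sup>2 = eps X * (w X a)\<^sup>2" "1 - (cosX X b)\<^sup>2 = eps X * (w X b)\<^sup>2"
      using cosX_w_square[of X a] cosX_w_square[of X b] by simp_all
    then show ?thesis by (simp add: power_mult_distrib)
  qed
  finally have le: "\<bar>cosX X c - cosX X a * cosX X b\<bar> \<le> \<bar>w X a * w X b\<bar>"
    by (simp add: abs_le_square_iff)
  show ?thesis
  proof (cases X)
    case S2R
    have pi: "a \<le> pi" "b \<le> pi" "c \<le> pi" using assms S2R by (auto simp: a_def b_def c_def ang_le_pi)
    show ?thesis
    proof (cases "a + b \<le> pi")
      case True
      have "cos (a + b) \<le> cos c"
        using le S2R nn pi by (simp add: cosX_def cos_add abs_mult sin_ge_zero)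
      then have "c \<le> a + b" using True nn pi by (subst (asm) cos_mono_le_eq) auto
      then show ?thesis by (simp add: a_def b_def c_def)
    qed (use pi in \<open>auto simp: a_def b_def c_def\<close>)
  next
    case H2R
    have "cosh c \<le> cosh (a + b)"
      using le H2R nn by (simp add: cosX_def cosh_add abs_mult)
    then show ?thesis using nn by (simp add: cosh_real_nonneg_le_iff a_def b_def c_def)
  qed
qed

lemma rho_nonneg [simp]: "0 \<le> rho X x y"
  by (simp add: rho_def)

lemma rho_square: "(rho X x y)\<^sup>2 = (height X x - height X y)\<^sup>2 + (ang X x y)\<^sup>2"
  by (simp add: rho_def)

lemma rho_commute: "rho X x y = rho X y x"
  by (simp add: rho_def ang_commute[of X x] power2_commute)

lemma rho_triangle:
  assumes "x \<in> points X" "y \<in> points X" "z \<in> points X"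
  shows "rho X x z \<le> rho X x y + rho X y z"
proof -
  have "rho X x z \<le> sqrt ((height X x - height X y + (height X y - height X z))\<^sup>2
      + (ang X x y + ang X y z)\<^sup>2)"
    using power_mono[OF ang_triangle[OF assms] ang_nonneg[OF assms(1,3)], of 2]
    by (simp add: rho_def)
  also have "\<dots> \<le> rho X x y + rho X y z"
    unfolding rho_def by (rule real_sqrt_sum_squares_triangle_ineq)
  finally show ?thesis .
qed

lemma rho_eq_0_iff:
  assumes "x \<in> points X" "y \<in> points X"
  shows "rho X x y = 0 \<longleftrightarrow> x = y"
proof
  assume "rho X x y = 0"
  then have "height X x = height X y" "unit X x = unit X y"
    using ang_eq_0_iff[OF assms] by (auto simp: rho_def add_nonneg_eq_0_iff)
  then show "x = y" using scale_unit assms by metis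
next
  assume "x = y"
  then show "rho X x y = 0" using ang_eq_0_iff[OF assms] by (simp add: rho_def)
qed

section \<open>Model geodesics\<close>

text \<open>A base point with a unit tangent vector. The square of \<open>b\<close> is
  \<open>eps X\<close> because tangent vectors of the hyperboloid are negative for
  \<open>mink\<close>.\<close>

definition frame :: "model \<Rightarrow> real^3 \<Rightarrow> real^3 \<Rightarrow> bool" where
  "frame X a b \<longleftrightarrow> a \<in> unit_points X \<and> bil X b b = eps X \<and> bil X a b = 0"

definition turn :: "model \<Rightarrow> real^3 \<Rightarrow> real^3 \<Rightarrow> real \<Rightarrow> real^3" where
  "turn X a b t = cosX X t *\<^sub>R a + w X t *\<^sub>R b"

text \<open>The base point moves with speed \<open>k\<close> while the height, starting at
  \<open>c\<close>, grows with slope \<open>s\<close>.\<close>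

definition gcurve :: "model \<Rightarrow> real^3 \<Rightarrow> real^3 \<Rightarrow> real \<Rightarrow> real \<Rightarrow> real \<Rightarrow> real \<Rightarrow> real^3" where
  "gcurve X a b c s k t = exp (c + s * t) *\<^sub>R turn X a b (k * t)"

text \<open>The first summand is the fibre part dt^2, the second the metric of the base; this makes
  the product structure visible for both models at once.\<close>

lemma ds2_eq:
  "ds2 X p u = (bil X p u / bil X p p)\<^sup>2
     + (eps X * (bil X u u / bil X p p) - eps X * (bil X p u / bil X p p)\<^sup>2)"
proof (induct X)
  case S2R
  show ?case unfolding eps_def bil_def model.case ds2.simps by simp
next
  case H2R
  show ?case unfolding eps_def bil_def model.case ds2.simps by simp
qed

lemma frame_bil:
  assumes "frame X a b"
  shows "bil X a a = 1" "bil X b b = eps X" "bil X a b = 0" "bil X b a = 0"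
  using assms by (auto simp: frame_def unit_points_def bil_commute[of X b a])

text \<open>The sign of the product with one point of the model tells the two sheets of the cone
  apart.\<close>

lemma pointsI_H2R:
  assumes "bil H2R z z > 0" "bil H2R a z > 0" "a \<in> points H2R"
  shows "z \<in> points H2R"
proof -
  have q: "(z$1)\<^sup>2 - (z$2)\<^sup>2 - (z$3)\<^sup>2 > 0"
    using assms(1) by (simp add: bil_def mink_def power2_eq_square)
  moreover have "z$1 > 0"
  proof (rule ccontr)
    assume n: "\<not> z$1 > 0"
    have "z$1 \<noteq> 0" using q by (smt (verit) power_zero_numeral zero_le_power2)
    then have "- z \<in> points H2R" using n q by simp
    then have "bil H2R a (- z) > 0" using points_H2R_gram(3) assms(3) by blast
    then show False using assms(2) by simp
  qed
  ultimately show ?thesis by simp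
qed

lemma bil_turn:
  assumes "frame X a b"
  shows "bil X (turn X a b s) (turn X a b t) = cosX X (s - t)"
  using frame_bil[OF assms] by (simp add: turn_def cosX_diff algebra_simps)

lemma turn_0 [simp]: "turn X a b 0 = a"
  by (simp add: turn_def)

lemma turn_unit_points:
  assumes "frame X a b"
  shows "turn X a b t \<in> unit_points X"
proof -
  have q: "bil X (turn X a b t) (turn X a b t) = 1" using bil_turn[OF assms] by simp
  have "turn X a b t \<in> points X"
  proof (cases X)
    case S2R
    have "turn X a b t \<noteq> 0" using q by auto
    then show ?thesis using S2R by simp
  next
    case H2R
    have "bil X a (turn X a b t) = cosX X t"
      using bil_turn[OF assms, of 0 t] by simp
    then show ?thesis using q pointsI_H2R[of "turn X a b t" a] H2R assms
      by (auto simp: cosX_def frame_def unit_points_def)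
  qed
  then show ?thesis using q by (simp add: unit_points_def)
qed

lemma gcurve_in_points: "frame X a b \<Longrightarrow> gcurve X a b c s k t \<in> points X"
  using turn_unit_points[of X a b "k * t"]
  by (simp add: gcurve_def points_scale unit_points_def)

lemma unit_gcurve: "frame X a b \<Longrightarrow> unit X (gcurve X a b c s k t) = turn X a b (k * t)"
  using turn_unit_points[of X a b "k * t"]
  by (simp add: gcurve_def unit_scale unit_points_subset)

lemma height_gcurve: "frame X a b \<Longrightarrow> height X (gcurve X a b c s k t) = c + s * t"
  using turn_unit_points[of X a b "k * t"]
  by (simp add: gcurve_def height_scale unit_points_subset)

lemma gcurve_0 [simp]: "gcurve X a b c s k 0 = exp c *\<^sub>R a"
  by (simp add: gcurve_def)

lemma ang_gcurve:
  assumes "frame X a b" "X = S2R \<Longrightarrow> \<bar>k * (t - t')\<bar> \<le> pi"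
  shows "ang X (gcurve X a b c s k t) (gcurve X a b c s k t') = \<bar>k * (t - t')\<bar>"
  using assms(2)
  by (intro ang_unique) (auto simp: unit_gcurve[OF assms(1)] bil_turn[OF assms(1)] right_diff_distrib)

lemma rho_gcurve:
  assumes "frame X a b" "X = S2R \<Longrightarrow> \<bar>k * (t - t')\<bar> \<le> pi"
  shows "rho X (gcurve X a b c s k t) (gcurve X a b c s k t') = sqrt (s\<^sup>2 + k\<^sup>2) * \<bar>t - t'\<bar>"
proof -
  have "(s * t - s * t')\<^sup>2 + (k * (t - t'))\<^sup>2 = (s\<^sup>2 + k\<^sup>2) * (t - t')\<^sup>2" by algebra
  then show ?thesis
    by (simp add: rho_def ang_gcurve[OF assms] height_gcurve[OF assms(1)] real_sqrt_mult)
qed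

text \<open>The parameter runs over [0,1], so slope and base speed are the height difference and the
  base distance, and the speed of the curve is \<open>rho X x y\<close>.\<close>

lemma gcurve_exists:
  assumes x: "x \<in> points X" and y: "y \<in> points X"
  obtains a b where "frame X a b"
    "gcurve X a b (height X x) (height X y - height X x) (ang X x y) 0 = x"
    "gcurve X a b (height X x) (height X y - height X x) (ang X x y) 1 = y"
proof -
  define a where "a = unit X x"
  define k where "k = ang X x y"
  have a: "a \<in> unit_points X" using unit_in_unit_points x a_def by blast
  have y1: "bil X (unit X y) (unit X y) = 1" by (rule bil_unit[OF y])
  have m: "bil X a (unit X y) = cosX X k" using cosX_ang[OF x y] by (simp add: a_def k_def)
  have "\<exists>b. frame X a b \<and> turn X a b k = unit X y"
  proof (cases "w X k = 0")
    case False
    \<comment> \<open>This solves \<open>turn X a b k = unit X y\<close> for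
      \<open>b\<close>.\<close>
    define b where "b = inverse (w X k) *\<^sub>R (unit X y - cosX X k *\<^sub>R a)"
    have a1: "bil X a a = 1" using a by (simp add: unit_points_def)
    have "bil X a b = 0" using m by (simp add: b_def a1)
    moreover have "bil X b b = eps X"
    proof -
      have "bil X b b = inverse (w X k) * inverse (w X k) * (1 - (cosX X k)\<^sup>2)"
        using m bil_commute[of X "unit X y" a]
        by (simp add: b_def a1 y1 power2_eq_square algebra_simps)
      also have "1 - (cosX X k)\<^sup>2 = eps X * (w X k * w X k)"
        using cosX_w_square[of X k] by (simp add: power2_eq_square)
      finally show ?thesis using False by (simp add: field_simps)
    qed
    ultimately have "frame X a b" using a by (simp add: frame_def)
    moreover have "turn X a b k = unit X y" using False by (simp add: turn_def b_def)
    ultimately show ?thesis by blast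
  next
    \<comment> \<open>Now the base points coincide or are antipodal on the sphere, and every tangent
      direction at \<open>a\<close> serves.\<close>
    case True
    have k: "k \<ge> 0" using ang_nonneg x y k_def by blast
    obtain b where b: "frame X a b"
    proof (cases X)
      case S2R
      obtain b where "b \<noteq> 0" "orthogonal a b"
        using orthogonal_to_vector_exists[of a] by auto
      then have "frame X a (b /\<^sub>R norm b)"
        using a S2R by (simp add: frame_def bil_def eps_def orthogonal_def dot_square_norm
            power2_eq_square)
      then show ?thesis using that by blast
    next
      case H2R
      have H: "a$1 > 0" "a$1 * a$1 - a$2 * a$2 - a$3 * a$3 = 1"
        using a H2R by (auto simp: unit_points_def bil_def mink_def)
      define r where "r = sqrt ((a$1)\<^sup>2 - (a$2)\<^sup>2)"
      have r: "r * r = (a$1)\<^sup>2 - (a$2)\<^sup>2" "r > 0"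
        unfolding r_def using H by (simp_all add: power2_eq_square) (smt (verit) mult_nonneg_nonneg zero_le_square)+
      \<comment> \<open>Exchanging the first two coordinates and dropping the third gives a vector
        orthogonal to \<open>a\<close> for \<open>mink\<close>; its negative square is normalised by
        \<open>r\<close>.\<close>
      define b :: "real^3" where "b = inverse r *\<^sub>R vector [a$2, a$1, 0]"
      have "bil X b b = inverse r * inverse r * (a$2 * a$2 - a$1 * a$1)"
        using H2R by (simp add: b_def) (simp add: bil_def mink_def)
      also have "\<dots> = - (inverse r * inverse r * (r * r))"
        unfolding r by (simp add: power2_eq_square algebra_simps)
      also have "\<dots> = -1" using r(2) by (simp add: field_simps)
      finally have "frame X a b" using a H2R
        by (simp add: frame_def eps_def) (simp add: b_def bil_def mink_def)
      then show ?thesis using that by blast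
    qed
    have "turn X a b k = unit X y"
    proof (cases "k = 0")
      case True
      then show ?thesis using ang_eq_0_iff[OF x y] by (simp add: a_def k_def)
    next
      case False
      have X: "X = S2R" using False True by (cases X) auto
      have "k = pi"
        using True False k ang_le_pi[of x y] x y X sin_gt_zero[of k] unfolding k_def
        by (metis ang_le_pi k_def less_eq_real_def order_less_irrefl w.simps(1))
      then have "bil X a (unit X y) = -1" using m X by (simp add: cosX_def)
      moreover have u: "unit X y \<in> unit_points X" using y unit_in_unit_points by blast
      ultimately have "cross3 a (unit X y) = 0"
        using a by (intro bil_cauchy_schwarz_eq[of _ X]) (auto simp: unit_points_def)
      then have "unit X y = - a"
        using cross3_unit_zero[OF a u] \<open>bil X a (unit X y) = -1\<close> a by (auto simp: unit_points_def)
      then show ?thesis using \<open>k = pi\<close> X by (simp add: turn_def cosX_def)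
    qed
    then show ?thesis using b by blast
  qed
  then obtain b where b: "frame X a b" "turn X a b k = unit X y" by blast
  show thesis
  proof (rule that[OF b(1)])
    show "gcurve X a b (height X x) (height X y - height X x) (ang X x y) 0 = x"
      using scale_unit[OF x] by (simp add: a_def)
    show "gcurve X a b (height X x) (height X y - height X x) (ang X x y) 1 = y"
      using scale_unit[OF y] b(2) by (simp add: gcurve_def k_def)
  qed
qed

lemma cosX_deriv: "(cosX X has_real_derivative (- eps X * w X t)) (at t)"
proof (cases X)
  case S2R
  have "cosX X = cos" using S2R by (auto simp: cosX_def fun_eq_iff)
  then show ?thesis using S2R by (simp add: eps_def)
next
  case H2R
  have "cosX X = cosh" using H2R by (auto simp: cosX_def fun_eq_iff)
  then show ?thesis using H2R by (auto simp: eps_def intro!: derivative_eq_intros)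
qed

lemma w_deriv: "(w X has_real_derivative cosX X t) (at t)"
proof (cases X)
  case S2R
  have "w X = sin" using S2R by (auto simp: fun_eq_iff)
  then show ?thesis using S2R by (simp add: cosX_def)
next
  case H2R
  have "w X = sinh" using H2R by (auto simp: fun_eq_iff)
  then show ?thesis using H2R by (auto simp: cosX_def intro!: derivative_eq_intros)
qed

lemma gcurve_deriv:
  assumes "frame X a b"
  obtains V where "(gcurve X a b c s k has_vector_derivative V) (at t)"
    "ds2 X (gcurve X a b c s k t) V = s\<^sup>2 + k\<^sup>2"
proof -
  \<comment> \<open>\<open>n'\<close> is the derivative of \<open>turn X a b\<close> at
    \<open>k * t\<close>. It is orthogonal to \<open>n\<close> with square \<open>eps X\<close>, so
    fibre speed and base speed separate.\<close>
  define n n' E where "n = turn X a b (k * t)"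
    and "n' = (- eps X * w X (k * t)) *\<^sub>R a + cosX X (k * t) *\<^sub>R b" and "E = exp (c + s * t)"
  define V where "V = E *\<^sub>R (s *\<^sub>R n + k *\<^sub>R n')"
  have 1: "((\<lambda>t. cosX X (k * t)) has_real_derivative (- eps X * w X (k * t)) * k) (at t)"
    by (rule DERIV_chain2[OF cosX_deriv]) (auto intro!: derivative_eq_intros)
  have 2: "((\<lambda>t. w X (k * t)) has_real_derivative cosX X (k * t) * k) (at t)"
    by (rule DERIV_chain2[OF w_deriv]) (auto intro!: derivative_eq_intros)
  have 3: "((\<lambda>t. exp (c + s * t)) has_real_derivative E * s) (at t)"
    unfolding E_def by (auto intro!: derivative_eq_intros)
  have "(gcurve X a b c s k has_vector_derivative
      E *\<^sub>R ((((- eps X * w X (k * t)) * k) *\<^sub>R a + 0) + ((cosX X (k * t) * k) *\<^sub>R b + 0)) + (E * s) *\<^sub>R n) (at t)"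
    unfolding gcurve_def[abs_def] turn_def E_def n_def
    using 1 2 3 unfolding has_real_derivative_iff_has_vector_derivative E_def
    by (auto intro!: derivative_eq_intros simp: has_real_derivative_iff_has_vector_derivative)
  also have "E *\<^sub>R ((((- eps X * w X (k * t)) * k) *\<^sub>R a + 0) + ((cosX X (k * t) * k) *\<^sub>R b + 0)) + (E * s) *\<^sub>R n = V"
    by (simp add: V_def n'_def algebra_simps)
  finally have d: "(gcurve X a b c s k has_vector_derivative V) (at t)" .
  have nn: "bil X n n = 1" using bil_turn[OF assms] by (simp add: n_def)
  have nn': "bil X n n' = 0"
    using frame_bil[OF assms] by (simp add: n_def n'_def turn_def algebra_simps)
  have n'n': "bil X n' n' = eps X"
  proof -
    have "bil X n' n' = (eps X * eps X) * (w X (k * t))\<^sup>2 + eps X * (cosX X (k * t))\<^sup>2"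
      using frame_bil[OF assms] by (simp add: n'_def algebra_simps power2_eq_square)
    also have "\<dots> = eps X * ((cosX X (k * t))\<^sup>2 + eps X * (w X (k * t))\<^sup>2)"
      by (simp add: algebra_simps power2_eq_square)
    finally show ?thesis by (simp add: cosX_w_square)
  qed
  have E: "E > 0" by (simp add: E_def)
  have p: "gcurve X a b c s k t = E *\<^sub>R n" by (simp add: gcurve_def E_def n_def)
  have B: "bil X (E *\<^sub>R n) (E *\<^sub>R n) = E\<^sup>2" "bil X (E *\<^sub>R n) V = E\<^sup>2 * s"
    "bil X V V = E\<^sup>2 * (s\<^sup>2 + eps X * k\<^sup>2)"
    using nn nn' n'n' bil_commute[of X n' n]
    by (simp_all add: V_def power2_eq_square algebra_simps)
  have "ds2 X (gcurve X a b c s k t) V = s\<^sup>2 + k\<^sup>2"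
  proof -
    have "eps X * (s\<^sup>2 + eps X * k\<^sup>2) = eps X * s\<^sup>2 + (eps X * eps X) * k\<^sup>2"
      by (simp add: algebra_simps)
    then show ?thesis
      unfolding p ds2_eq B using E by simp
  qed
  with d show thesis using that by blast
qed

lemma bounded_bilinear_bil: "bounded_bilinear (bil X)"
  by (simp add: bilinear_def linear_iff flip: bilinear_conv_bounded_bilinear)

lemma sinh_ge_self: "0 \<le> x \<Longrightarrow> x \<le> sinh (x::real)"
proof -
  assume x: "0 \<le> x"
  have "sinh 0 - 0 \<le> sinh x - x"
  proof (rule DERIV_nonneg_imp_nondecreasing[OF x])
    fix y :: real
    show "\<exists>z. ((\<lambda>x. sinh x - x) has_real_derivative z) (at y) \<and> 0 \<le> z"
      by (rule exI[of _ "cosh y - 1"]) (auto intro!: derivative_eq_intros simp: cosh_real_ge_1)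
  qed
  then show ?thesis by simp
qed

text \<open>\<open>arccos\<close> and \<open>arcosh\<close> are not differentiable at 1, where two
  points merge. Comparing an angle with its tangent, or with its hyperbolic sine, gives a bound free
  of them; the factor \<open>max m (1 / m)\<close> covers both cases and tends to 1.\<close>

lemma ang_le:
  assumes x: "x \<in> points X" and y: "y \<in> points X"
    and m: "m = bil X (unit X x) (unit X y)" "m > 0"
  shows "ang X x y \<le> sqrt (eps X * (1 - m\<^sup>2)) * max m (1 / m)"
proof (cases X)
  case S2R
  have m1: "m \<le> 1" using bil_unit_bounds(1)[OF x y S2R] m by simp
  define t where "t = arccos m"
  have t: "0 \<le> t" "t < pi / 2" using m1 m(2) arccos_less_arccos[of 0 m]
    by (auto simp: t_def arccos_lbound)
  have "t \<le> tan t" using abs_tan_ge[of t] t tan_pos_pi2_le[of t] by simp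
  also have "tan t = sqrt (1 - m\<^sup>2) / m"
    using m1 m(2) by (simp add: t_def tan_def sin_arccos)
  also have "\<dots> \<le> sqrt (1 - m\<^sup>2) * max m (1 / m)"
    using m1 m(2) by (simp add: divide_inverse mult_left_mono abs_square_le_1)
  finally show ?thesis using S2R m by (simp add: ang_def eps_def t_def)
next
  case H2R
  have m1: "m \<ge> 1" using bil_unit_bounds(2)[OF x y H2R] m by simp
  have "arcosh m \<le> sinh (arcosh m)" using m1 by (intro sinh_ge_self) simp
  also have "\<dots> = sqrt (m\<^sup>2 - 1) * 1" using m1 by (simp add: sinh_arcosh_real)
  also have "\<dots> \<le> sqrt (m\<^sup>2 - 1) * max m (1 / m)"
    using m1 by (intro mult_left_mono) auto
  finally show ?thesis using H2R m by (simp add: ang_def eps_def)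
qed

section \<open>Isometries preserve the product distance\<close>

lemma has_vector_derivative_quotient:
  "(f has_vector_derivative D) (at s) \<longleftrightarrow>
    ((\<lambda>t. (f t - f s) /\<^sub>R (t - s)) \<longlongrightarrow> D) (at s)" for f :: "real \<Rightarrow> 'a::real_normed_vector"
proof -
  define G where "G = (\<lambda>t. f t - f s - (t - s) *\<^sub>R D)"
  have "(f has_vector_derivative D) (at s) \<longleftrightarrow> ((\<lambda>t. G t /\<^sub>R norm (t - s)) \<longlongrightarrow> 0) (at s)"
    by (simp add: has_vector_derivative_def has_derivative_at_within bounded_linear_scaleR_left G_def)
  also have "\<dots> \<longleftrightarrow> ((\<lambda>t. norm (G t /\<^sub>R norm (t - s))) \<longlongrightarrow> 0) (at s)"
    by (simp only: tendsto_norm_zero_iff)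
  also have "(\<lambda>t. norm (G t /\<^sub>R norm (t - s))) = (\<lambda>t. norm (G t /\<^sub>R (t - s)))"
    by auto
  also have "((\<lambda>t. norm (G t /\<^sub>R (t - s))) \<longlongrightarrow> 0) (at s)
      \<longleftrightarrow> ((\<lambda>t. G t /\<^sub>R (t - s)) \<longlongrightarrow> 0) (at s)"
    by (simp only: tendsto_norm_zero_iff)
  also have "\<dots> \<longleftrightarrow> ((\<lambda>t. (f t - f s) /\<^sub>R (t - s) - D) \<longlongrightarrow> 0) (at s)"
    by (rule filterlim_cong[OF refl refl])
       (auto simp: eventually_at_filter G_def scaleR_right_diff_distrib)
  also have "\<dots> \<longleftrightarrow> ((\<lambda>t. (f t - f s) /\<^sub>R (t - s)) \<longlongrightarrow> D) (at s)"
    by (simp only: LIM_zero_iff)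
  finally show ?thesis .
qed

lemma bil_unit_eq:
  "bil X (unit X x) (unit X y) = bil X x y / (sqrt (bil X x x) * sqrt (bil X y y))"
  by (simp add: unit_def field_simps)

text \<open>To first order the chord is at most the norm of the velocity times the increment of the
  parameter. Strictness of the bound by \<open>K\<close> absorbs the error term.\<close>

lemma rho_first_order:
  assumes C: "(C has_vector_derivative V) (at s)" and pts: "\<And>t. C t \<in> points X"
    and sp: "ds2 X (C s) V < K\<^sup>2" and K: "K \<ge> 0"
  shows "\<forall>\<^sub>F t in at s. rho X (C s) (C t) \<le> K * \<bar>t - s\<bar>"
proof -
  define x h q m where "x = C s" and "h = (\<lambda>t. (C t - C s) /\<^sub>R (t - s))"
    and "q = (\<lambda>t. bil X (C t) (C t))" and "m = (\<lambda>t. bil X (unit X x) (unit X (C t)))"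
  have qpos: "q t > 0" for t unfolding q_def using bil_pos pts by blast
  have h: "(h \<longlongrightarrow> V) (at s)"
    using C unfolding has_vector_derivative_quotient h_def .
  have "isCont C s" using C has_vector_derivative_continuous by blast
  then have C0: "(C \<longlongrightarrow> x) (at s)" by (simp add: isCont_def x_def)
  note bl = bounded_bilinear.tendsto[OF bounded_bilinear_bil[of X]]
  have q0: "(q \<longlongrightarrow> q s) (at s)" unfolding q_def using bl[OF C0 C0] by (simp add: x_def)
  have "(q has_vector_derivative (bil X (C s) V + bil X V (C s))) (at s)"
    unfolding q_def
    using bounded_bilinear.has_vector_derivative[OF bounded_bilinear_bil C C] by simp
  then have "(q has_real_derivative (2 * bil X x V)) (at s)"
    by (simp add: has_real_derivative_iff_has_vector_derivative x_def bil_commute[of X V "C s"])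
  then have "((\<lambda>t. ln (q t) / 2) has_real_derivative bil X x V / q s) (at s)"
    using qpos[of s] by (auto intro!: derivative_eq_intros)
  then have H: "((\<lambda>t. (height X (C t) - height X x) / (t - s)) \<longlongrightarrow> bil X x V / q s) (at s)"
    unfolding has_field_derivative_iff height_def q_def x_def by simp
  have m_eq: "m t = bil X x (C t) / (sqrt (q s) * sqrt (q t))" for t
    unfolding m_def bil_unit_eq q_def x_def ..
  have m0: "(m \<longlongrightarrow> 1) (at s)"
  proof -
    have "(m \<longlongrightarrow> bil X x x / (sqrt (q s) * sqrt (q s))) (at s)"
      unfolding m_eq using qpos[of s]
      by (intro tendsto_intros bl C0 q0) auto
    then show ?thesis using qpos[of s] by (simp add: q_def x_def)
  qed
  \<comment> \<open>\<open>F t\<close> dominates the square of the difference quotient of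
    \<open>rho\<close>, with the angle replaced by the bound of \<open>ang_le\<close>; its limit is
    \<open>ds2 X (C s) V\<close>.\<close>
  define F where "F = (\<lambda>t. ((height X (C t) - height X x) / (t - s))\<^sup>2 +
    eps X * (q s * bil X (h t) (h t) - (bil X x (h t))\<^sup>2) / (q s * q t) * (max (m t) (1 / m t))\<^sup>2)"
  have "(F \<longlongrightarrow> (bil X x V / q s)\<^sup>2 +
      eps X * (q s * bil X V V - (bil X x V)\<^sup>2) / (q s * q s) * (max 1 (1 / 1))\<^sup>2) (at s)"
    unfolding F_def using qpos[of s]
    by (intro tendsto_intros tendsto_max bl H h q0 m0) auto
  moreover have "(bil X x V / q s)\<^sup>2 +
      eps X * (q s * bil X V V - (bil X x V)\<^sup>2) / (q s * q s) * (max 1 (1 / 1))\<^sup>2 = ds2 X (C s) V"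
    using qpos[of s] unfolding ds2_eq
    by (simp add: q_def x_def diff_divide_distrib right_diff_distrib power2_eq_square)
  ultimately have "(F \<longlongrightarrow> ds2 X (C s) V) (at s)" by simp
  then have "\<forall>\<^sub>F t in at s. F t < K\<^sup>2" using sp by (rule order_tendstoD)
  moreover have "\<forall>\<^sub>F t in at s. m t > 0" using m0 by (rule order_tendstoD) simp
  moreover have "\<forall>\<^sub>F t in at s. t \<noteq> s" by (simp add: eventually_at_filter)
  ultimately show ?thesis
  proof eventually_elim
    case (elim t)
    define d where "d = t - s"
    have d: "d \<noteq> 0" using elim by (simp add: d_def)
    have Ct: "C t = x + d *\<^sub>R h t" using d by (simp add: h_def d_def x_def)
    have z: "eps X * (1 - (m t)\<^sup>2) =
        eps X * (q s * bil X (h t) (h t) - (bil X x (h t))\<^sup>2) / (q s * q t) * d\<^sup>2"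
    proof -
      have "(m t)\<^sup>2 = (bil X x (C t))\<^sup>2 / (q s * q t)"
        unfolding m_eq using qpos[of s] qpos[of t] by (simp add: power_divide power_mult_distrib)
      then have "1 - (m t)\<^sup>2 = (q s * q t - (bil X x (C t))\<^sup>2) / (q s * q t)"
        using qpos[of s] qpos[of t] by (simp add: diff_divide_distrib)
      \<comment> \<open>Adding a multiple of \<open>x\<close> to a vector does not change its Gram
        determinant with \<open>x\<close>, so the factor \<open>d\<close> squared comes out
        exactly.\<close>
      also have "q s * q t - (bil X x (C t))\<^sup>2
          = (q s * bil X (h t) (h t) - (bil X x (h t))\<^sup>2) * d\<^sup>2"
        unfolding q_def Ct x_def[symmetric]
        by (simp add: bil_commute[of X "h t" x] power2_eq_square algebra_simps)
      finally show ?thesis by simp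
    qed
    have ang0: "0 \<le> ang X x (C t)" using ang_nonneg pts x_def by blast
    have ge: "0 \<le> eps X * (1 - (m t)\<^sup>2)"
      using bil_cauchy_schwarz[of "unit X x" X "unit X (C t)"] pts
      by (simp add: bil_unit unit_in_unit_points unit_points_subset x_def m_def)
    have "ang X x (C t) \<le> sqrt (eps X * (1 - (m t)\<^sup>2)) * max (m t) (1 / m t)"
      using elim pts x_def by (intro ang_le) (auto simp: m_def)
    then have "(ang X x (C t))\<^sup>2 \<le> (sqrt (eps X * (1 - (m t)\<^sup>2)) * max (m t) (1 / m t))\<^sup>2"
      using ang0 by (rule power_mono)
    also have "\<dots> = (eps X * (1 - (m t)\<^sup>2)) * (max (m t) (1 / m t))\<^sup>2"
      using ge by (simp add: power_mult_distrib)
    finally have "(rho X x (C t))\<^sup>2 \<le> (height X x - height X (C t))\<^sup>2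
        + (eps X * (1 - (m t)\<^sup>2)) * (max (m t) (1 / m t))\<^sup>2"
      by (simp add: rho_square)
    also have "\<dots> = F t * d\<^sup>2"
      unfolding z F_def using d by (simp add: d_def[symmetric] power_divide power2_commute[of "height X x"] algebra_simps)
    also have "\<dots> \<le> K\<^sup>2 * d\<^sup>2" using elim by (intro mult_right_mono) auto
    also have "\<dots> = (K * \<bar>d\<bar>)\<^sup>2" by (simp add: power_mult_distrib)
    finally show "rho X (C s) (C t) \<le> K * \<bar>t - s\<bar>"
      using K by (auto simp: x_def d_def dest: power2_le_imp_le)
  qed
qed

text \<open>The estimate with \<open>k + e\<close> holds for short intervals around each point and
  is passed to adjacent intervals by the triangle inequality, so bisection carries it to [0,1]. The
  slack \<open>e\<close> pays for the strict inequality of \<open>rho_first_order\<close>.\<close>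

lemma rho_le_length:
  assumes C: "\<And>s. \<exists>V. (C has_vector_derivative V) (at s) \<and> ds2 X (C s) V = k\<^sup>2"
    and pts: "\<And>t. C t \<in> points X" and k: "k \<ge> 0"
  shows "rho X (C 0) (C 1) \<le> k"
proof (rule field_le_epsilon)
  fix e :: real assume e: "e > 0"
  have "(0::real) \<le> 1" by simp
  then have "rho X (C 0) (C 1) \<le> (k + e) * (1 - 0)"
  proof (induction rule: Bolzano)
    case (trans a b c)
    then show ?case using rho_triangle[OF pts[of a] pts[of b] pts[of c]] by (simp add: algebra_simps)
  next
    case (local x)
    obtain V where V: "(C has_vector_derivative V) (at x)" "ds2 X (C x) V = k\<^sup>2" using C by blast
    have "k\<^sup>2 < (k + e)\<^sup>2" using k e by (intro power_strict_mono) auto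
    then have "\<forall>\<^sub>F t in at x. rho X (C x) (C t) \<le> (k + e) * \<bar>t - x\<bar>"
      using V k e by (intro rho_first_order[OF V(1)] pts) auto
    then obtain d where d: "d > 0" "\<And>t. t \<noteq> x \<Longrightarrow> dist t x < d \<Longrightarrow> rho X (C x) (C t) \<le> (k + e) * \<bar>t - x\<bar>"
      unfolding eventually_at by auto
    have near: "rho X (C x) (C t) \<le> (k + e) * \<bar>t - x\<bar>" if "dist t x < d" for t
      using d(2)[of t] that rho_eq_0_iff[OF pts pts, of x x] by (cases "t = x") auto
    show ?case
    proof (rule exI[of _ d], intro conjI allI impI d(1))
      fix a b assume ab: "a \<le> x \<and> x \<le> b \<and> b - a < d"
      have "rho X (C a) (C b) \<le> rho X (C x) (C a) + rho X (C x) (C b)"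
        using rho_triangle[OF pts[of a] pts[of x] pts[of b]] rho_commute[of X "C a" "C x"] by simp
      also have "\<dots> \<le> (k + e) * \<bar>a - x\<bar> + (k + e) * \<bar>b - x\<bar>"
        using ab by (intro add_mono near) (auto simp: dist_real_def)
      also have "\<dots> = (k + e) * (b - a)" using ab by (simp add: algebra_simps)
      finally show "rho X (C a) (C b) \<le> (k + e) * (b - a)" .
    qed
  qed
  then show "rho X (C 0) (C 1) \<le> k + e" by simp
qed

text \<open>The model curve from \<open>x\<close> to \<open>y\<close> has constant speed
  \<open>rho X x y\<close> on [0,1], and so has its image under \<open>f\<close>.\<close>

lemma rho_contraction:
  assumes f: "\<And>p. p \<in> points X \<Longrightarrow> f p \<in> points X"
    and D: "\<And>p. p \<in> points X \<Longrightarrow> (f has_derivative D p) (at p)"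
    and I: "\<And>p u. p \<in> points X \<Longrightarrow> ds2 X (f p) (D p u) = ds2 X p u"
    and x: "x \<in> points X" and y: "y \<in> points X"
  shows "rho X (f x) (f y) \<le> rho X x y"
proof -
  obtain a b where fr: "frame X a b"
    and e: "gcurve X a b (height X x) (height X y - height X x) (ang X x y) 0 = x"
    "gcurve X a b (height X x) (height X y - height X x) (ang X x y) 1 = y"
    using gcurve_exists[OF x y] by blast
  define c where "c = gcurve X a b (height X x) (height X y - height X x) (ang X x y)"
  have c: "c t \<in> points X" for t unfolding c_def using gcurve_in_points[OF fr] .
  have "rho X ((f \<circ> c) 0) ((f \<circ> c) 1) \<le> rho X x y"
  proof (rule rho_le_length)
    fix s
    obtain V where V: "(c has_vector_derivative V) (at s)"
      "ds2 X (c s) V = (height X y - height X x)\<^sup>2 + (ang X x y)\<^sup>2"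
      unfolding c_def using gcurve_deriv[OF fr] by metis
    have "(f \<circ> c has_vector_derivative D (c s) V) (at s)"
      using vector_derivative_diff_chain_within[OF V(1), of f "D (c s)"] D[OF c]
      by (simp add: has_derivative_at_withinI)
    then show "\<exists>V. (f \<circ> c has_vector_derivative V) (at s) \<and> ds2 X ((f \<circ> c) s) V = (rho X x y)\<^sup>2"
      using I[OF c, of s V] V(2) by (auto simp: rho_square power2_commute[of "height X x"])
  qed (use f c in auto)
  then show ?thesis using e by (simp add: c_def)
qed

text \<open>For the Lorentzian form the numerator is a square plus a Gram term. The Gram term
  vanishes only for \<open>u\<close> parallel to \<open>p\<close>, and then the square is positive.
  Definiteness makes the derivative of an isometry invertible.\<close>

lemma ds2_pos: "p \<in> points X \<Longrightarrow> u \<noteq> 0 \<Longrightarrow> ds2 X p u > 0"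
proof (cases X)
  case S2R
  assume "p \<in> points X" "u \<noteq> 0"
  then show ?thesis using S2R by simp
next
  case H2R
  assume p: "p \<in> points X" and u: "u \<noteq> 0"
  let ?b = "mink p u" and ?q = "mink p p"
  have q: "?q > 0" using bil_pos[OF p] H2R by (simp add: bil_def)
  have p1: "p$1 > 0" "(p$1)\<^sup>2 - (p$2)\<^sup>2 - (p$3)\<^sup>2 > 0" using p H2R by auto
  have "2 * ?b\<^sup>2 - mink u u * ?q > 0"
  proof -
    define d e where "d = p$1 * u$2 - p$2 * u$1" and "e = p$1 * u$3 - p$3 * u$1"
    have ge: "((p$1)\<^sup>2 - (p$2)\<^sup>2 - (p$3)\<^sup>2) * (d\<^sup>2 + e\<^sup>2) \<le> (p$1)\<^sup>2 * (?b\<^sup>2 - mink u u * ?q)"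
      using bil_H2R_lagrange_ge[of p u] by (simp add: bil_def d_def e_def mult.commute)
    show ?thesis
    proof (cases "d\<^sup>2 + e\<^sup>2 = 0")
      case False
      then have "(p$1)\<^sup>2 * (?b\<^sup>2 - mink u u * ?q) > 0"
        using ge p1(2) by (smt (verit) mult_pos_pos sum_power2_ge_zero)
      then have "?b\<^sup>2 - mink u u * ?q > 0" using p1(1) by (simp add: zero_less_mult_iff)
      then show ?thesis by (smt (verit) zero_le_power2)
    next
      case True
      then have "d = 0" "e = 0" by (simp_all add: sum_power2_eq_zero_iff)
      then have u': "p$1 *\<^sub>R u = u$1 *\<^sub>R p"
        by (simp add: vec_eq_iff forall_3 d_def e_def mult.commute)
      then have "u$1 \<noteq> 0" using u p1 by auto
      have "p$1 * ?b = u$1 * ?q"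
        using arg_cong[OF u', of "mink p"] by (simp add: mink_def algebra_simps)
      then have "?b \<noteq> 0" using \<open>u$1 \<noteq> 0\<close> q by auto
      moreover have "?b\<^sup>2 - mink u u * ?q \<ge> 0"
      proof -
        have "(p$1)\<^sup>2 * (?b\<^sup>2 - mink u u * ?q) \<ge> 0" using ge True by simp
        then show ?thesis using p1(1) by (simp add: zero_le_mult_iff)
      qed
      ultimately show ?thesis by (smt (verit) zero_less_power2)
    qed
  qed
  then have "(2 * ?b\<^sup>2 - mink u u * ?q) / ?q\<^sup>2 > 0" using q by simp
  then show ?thesis using H2R q by (simp add: diff_divide_distrib power_divide power2_eq_square)
qed

text \<open>Contraction is applied to \<open>f\<close> and to its inverse. The inverse is
  differentiable because each \<open>D p\<close> is injective, hence invertible in finite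
  dimension.\<close>

lemma isometry_rho:
  assumes f: "orientation_preserving_isometry X f"
    and x: "x \<in> points X" and y: "y \<in> points X"
  shows "rho X (f x) (f y) = rho X x y"
proof -
  obtain D where bij: "bij_betw f (points X) (points X)"
    and D: "\<And>p. p \<in> points X \<Longrightarrow> (f has_derivative D p) (at p)"
    and I: "\<And>p u. p \<in> points X \<Longrightarrow> ds2 X (f p) (D p u) = ds2 X p u"
    using f unfolding orientation_preserving_isometry_def by blast
  have fX: "f p \<in> points X" if "p \<in> points X" for p using bij that bij_betwE by blast
  define g where "g = inv_into (points X) f"
  have gX: "g p \<in> points X" if "p \<in> points X" for p
    unfolding g_def using bij that by (metis bij_betw_imp_surj_on inv_into_into)
  have gf: "g (f p) = p" if "p \<in> points X" for p
    unfolding g_def using bij that by (simp add: bij_betw_inv_into_left)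
  have fg: "f (g p) = p" if "p \<in> points X" for p
    unfolding g_def using bij that by (simp add: bij_betw_inv_into_right)
  have cont: "continuous_on (points X) f"
    using D by (intro continuous_at_imp_continuous_on ballI) (rule has_derivative_continuous)
  have inv: "\<exists>E. D p \<circ> E = id \<and> (\<forall>u. D p (E u) = u)" if p: "p \<in> points X" for p
  proof -
    have lin: "linear (D p)" using D[OF p] has_derivative_linear by blast
    have "inj (D p)"
    proof (rule linear_injective_0[OF lin, THEN iffD2], intro allI impI)
      fix v assume "D p v = 0"
      then have "ds2 X p v = 0" using I[OF p, of v] by (cases X) (simp_all add: mink_def)
      then show "v = 0" using ds2_pos[OF p, of v] by force
    qed
    then have "surj (D p)" using linear_injective_imp_surjective lin by blast
    then show ?thesis by (metis comp_apply eq_id_iff surj_f_inv_f)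
  qed
  then obtain E where E: "\<And>p. p \<in> points X \<Longrightarrow> D p \<circ> E p = id"
    "\<And>p u. p \<in> points X \<Longrightarrow> D p (E p u) = u" by metis
  have gD: "(g has_derivative E (g p)) (at p)" if p: "p \<in> points X" for p
    using has_derivative_inverse_strong[OF open_points gX[OF p] cont gf D[OF gX[OF p]] E(1)[OF gX[OF p]]]
    by (simp add: fg[OF p])
  have gI: "ds2 X (g p) (E (g p) u) = ds2 X p u" if p: "p \<in> points X" for p u
    using I[OF gX[OF p], of "E (g p) u"] E(2)[OF gX[OF p]] fg[OF p] by simp
  have "rho X (f x) (f y) \<le> rho X x y" by (rule rho_contraction[OF fX D I x y])
  moreover have "rho X (g (f x)) (g (f y)) \<le> rho X (f x) (f y)"
    by (rule rho_contraction[of X g "\<lambda>p. E (g p)", OF gX gD gI fX[OF x] fX[OF y]])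
  ultimately show ?thesis using gf x y by simp
qed

section \<open>Rigidity of distance-preserving bijections\<close>

text \<open>From here on only the distance matters; differentiability and orientation are
  dropped.\<close>

definition rho_bij :: "model \<Rightarrow> (real^3 \<Rightarrow> real^3) \<Rightarrow> bool" where
  "rho_bij X f \<longleftrightarrow> bij_betw f (points X) (points X) \<and>
     (\<forall>x\<in>points X. \<forall>y\<in>points X. rho X (f x) (f y) = rho X x y)"

lemma isometry_rho_bij: "orientation_preserving_isometry X f \<Longrightarrow> rho_bij X f"
  using isometry_rho by (auto simp: rho_bij_def orientation_preserving_isometry_def)

lemma rho_bij_in: "rho_bij X f \<Longrightarrow> x \<in> points X \<Longrightarrow> f x \<in> points X"
  unfolding rho_bij_def using bij_betwE by blast

lemma rho_bij_rho:
  "rho_bij X f \<Longrightarrow> x \<in> points X \<Longrightarrow> y \<in> points X \<Longrightarrow> rho X (f x) (f y) = rho X x y"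
  unfolding rho_bij_def by blast

lemma rho_bij_surj:
  assumes "rho_bij X f" "y \<in> points X"
  obtains x where "x \<in> points X" "f x = y"
proof -
  have "f ` points X = points X" using assms(1) by (simp add: rho_bij_def bij_betw_imp_surj_on)
  then show thesis using that assms(2) by (metis imageE)
qed

lemma rho_bij_inv:
  assumes f: "rho_bij X f"
  obtains g where "rho_bij X g" "\<And>x. x \<in> points X \<Longrightarrow> g (f x) = x"
proof -
  define g where "g = inv_into (points X) f"
  have bij: "bij_betw f (points X) (points X)" using f by (simp add: rho_bij_def)
  have g: "bij_betw g (points X) (points X)" unfolding g_def by (rule bij_betw_inv_into[OF bij])
  have fg: "f (g p) = p" if "p \<in> points X" for p
    unfolding g_def using bij that by (simp add: bij_betw_inv_into_right)
  have gX: "g p \<in> points X" if "p \<in> points X" for p using g that bij_betwE by blast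
  have "rho X (g x) (g y) = rho X x y" if "x \<in> points X" "y \<in> points X" for x y
    using rho_bij_rho[OF f gX[OF that(1)] gX[OF that(2)]] fg that by simp
  then have "rho_bij X g" using g by (simp add: rho_bij_def)
  moreover have "g (f x) = x" if "x \<in> points X" for x
    unfolding g_def using bij that by (simp add: bij_betw_inv_into_left)
  ultimately show thesis using that by blast
qed

lemma height_exp: "p \<in> points X \<Longrightarrow> height X (exp s *\<^sub>R p) = s + height X p"
  by (simp add: height_scale)

lemma ang_exp: "p \<in> points X \<Longrightarrow> ang X (exp s *\<^sub>R p) q = ang X p q"
  by (simp add: ang_def unit_scale)

lemma ang_unit: "p \<in> points X \<Longrightarrow> q \<in> points X \<Longrightarrow> ang X (unit X p) q = ang X p q"
  by (simp add: ang_def)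

text \<open>Only the height changes along a fibre, so this is the median identity of the real line.
  As it holds for every \<open>q\<close>, it survives a distance-preserving bijection.\<close>

lemma fibre_parallelogram:
  assumes "p \<in> points X"
  shows "(rho X (exp s *\<^sub>R p) q)\<^sup>2 + (rho X (exp (- s) *\<^sub>R p) q)\<^sup>2 = 2 * s\<^sup>2 + 2 * (rho X p q)\<^sup>2"
  unfolding rho_square height_exp[OF assms] ang_exp[OF assms] by algebra

text \<open>Test the identity at the antipode of \<open>x\<close>: the right side exceeds 2 pi^2 by
  2 t^2, but no distance on the sphere is larger than pi.\<close>

lemma parallelogram_rigid_S2R:
  assumes x: "x \<in> points S2R" "y \<in> points S2R" "z \<in> points S2R"
    and par: "\<And>p. p \<in> points S2R \<Longrightarrow>
      (ang S2R y p)\<^sup>2 + (ang S2R z p)\<^sup>2 = 2 * t\<^sup>2 + 2 * (ang S2R x p)\<^sup>2"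
  shows "t = 0"
proof -
  have x': "- x \<in> points S2R" using x by simp
  have "unit S2R (- x) = - unit S2R x" by (simp add: unit_def)
  then have pi: "ang S2R x (- x) = pi"
    by (intro ang_unique) (auto simp: cosX_def bil_unit[OF x(1)])
  have "(ang S2R y (- x))\<^sup>2 \<le> pi\<^sup>2" "(ang S2R z (- x))\<^sup>2 \<le> pi\<^sup>2"
    using x x' ang_nonneg ang_le_pi by (meson power_mono)+
  then have "t\<^sup>2 \<le> 0" using par[OF x', unfolded pi] by linarith
  then show ?thesis by simp
qed

lemma cosh_add_le: "0 \<le> d \<Longrightarrow> cosh (r + d) \<le> exp d * cosh (r::real)"
proof -
  assume "0 \<le> d"
  then have "exp (- r) * exp (- d) \<le> exp (- r) * exp d" by simp
  then show ?thesis by (simp add: cosh_field_def exp_add exp_diff exp_minus field_simps)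
qed

text \<open>The product \<open>cosh t * cosh r\<close> is cosh of the hypotenuse of a hyperbolic
  right triangle with legs t and r, which is thus longer than the Euclidean one. One long leg r is
  enough here.\<close>

lemma cosh_sqrt_less:
  fixes t :: real
  assumes "t > 0"
  obtains r where "r > 0" "cosh (sqrt (t\<^sup>2 + r\<^sup>2)) < cosh t * cosh r"
proof -
  have "cosh t > 1"
    using assms cosh_real_strict_mono[of 0 t] by simp
  then have L: "ln (cosh t) > 0" by simp
  \<comment> \<open>Half the logarithm leaves room for a strict inequality. Then r is chosen with 2
    r d = t^2, so that the Euclidean hypotenuse is at most r + d.\<close>
  define d where "d = ln (cosh t) / 2"
  define r where "r = t\<^sup>2 / (2 * d)"
  have d: "d > 0" using L by (simp add: d_def)
  have r: "r > 0" using assms d by (simp add: r_def)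
  have "t\<^sup>2 + r\<^sup>2 \<le> (r + d)\<^sup>2"
  proof -
    have "2 * r * d = t\<^sup>2" using d by (simp add: r_def)
    then show ?thesis by (simp add: power2_eq_square algebra_simps)
  qed
  then have "sqrt (t\<^sup>2 + r\<^sup>2) \<le> r + d" using r d by (intro real_le_lsqrt) auto
  then have "cosh (sqrt (t\<^sup>2 + r\<^sup>2)) \<le> cosh (r + d)"
    using r d by (subst cosh_real_nonneg_le_iff) auto
  also have "\<dots> \<le> exp d * cosh r" using d by (intro cosh_add_le) simp
  also have "\<dots> < cosh t * cosh r"
  proof -
    have "d < ln (cosh t)" using L by (simp add: d_def)
    then have "exp d < exp (ln (cosh t))" by (simp only: exp_less_mono)
    then have "exp d < cosh t" by (simp add: cosh_real_pos)
    then show ?thesis by (simp add: cosh_real_pos)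
  qed
  finally show thesis using that r by blast
qed

text \<open>The parallelogram identity fails at points far out on the perpendicular at \<open>x\<close> to the geodesic
  from \<open>x\<close> to \<open>y\<close>, by strict negative curvature.\<close>

lemma parallelogram_rigid_H2R:
  assumes pts: "x \<in> points H2R" "y \<in> points H2R" "z \<in> points H2R"
    and t: "ang H2R x y = t" "ang H2R x z = t"
    and par: "\<And>p. p \<in> points H2R \<Longrightarrow>
      (ang H2R y p)\<^sup>2 + (ang H2R z p)\<^sup>2 = 2 * t\<^sup>2 + 2 * (ang H2R x p)\<^sup>2"
  shows "t = 0"
proof (rule ccontr)
  assume "t \<noteq> 0"
  then have t0: "t > 0" using ang_nonneg[OF pts(1,2)] t by simp
  define a a1 a2 where "a = unit H2R x" and "a1 = unit H2R y" and "a2 = unit H2R z"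
  have u: "a \<in> unit_points H2R" "a1 \<in> unit_points H2R" "a2 \<in> unit_points H2R"
    unfolding a_def a1_def a2_def using pts unit_in_unit_points by blast+
  have ch: "bil H2R a a1 = cosh t" "bil H2R a a2 = cosh t"
    using cosX_ang[OF pts(1,2)] cosX_ang[OF pts(1,3)] t by (simp_all add: cosX_def a_def a1_def a2_def)
  define n where "n = cross3 a a1"
  \<comment> \<open>Lowering indices by the Lorentzian form turns the cross product \<open>n\<close>
    into the common normal of \<open>a\<close> and \<open>a1\<close> for \<open>bil\<close>.\<close>
  define v :: "real^3" where "v = vector [n$1, - n$2, - n$3]"
  have bv: "bil H2R p v = n \<bullet> p" for p
    by (simp add: bil_def mink_def v_def inner_vec_def sum_3 algebra_simps)
  have "bil H2R v v = - ((bil H2R a a1)\<^sup>2 - bil H2R a a * bil H2R a1 a1)"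
    unfolding bil_H2R_lagrange
    by (simp add: bil_def mink_def v_def n_def cross3_def) algebra
  also have "\<dots> = - (sinh t)\<^sup>2"
    using u ch cosh_square_eq[of t] by (simp add: unit_points_def)
  finally have vv: "bil H2R v v = - (sinh t)\<^sup>2" .
  have s: "sinh t > 0" using t0 by simp
  \<comment> \<open>\<open>z\<close> need not be the reflection of \<open>y\<close> in
    \<open>x\<close>. The sign puts the test point on the side where it is at least as far from
    \<open>z\<close> as from \<open>y\<close>.\<close>
  define sg :: real where "sg = (if bil H2R a2 v \<ge> 0 then 1 else -1)"
  define e where "e = (sg / sinh t) *\<^sub>R v"
  have sg: "sg * sg = 1" by (simp add: sg_def)
  have "bil H2R e e = sg * sg * (- 1)"
    using s vv by (simp add: e_def power2_eq_square)
  then have ee: "bil H2R e e = eps H2R" using sg by (simp add: eps_def)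
  have "bil H2R a v = 0" "bil H2R a1 v = 0"
    unfolding bv n_def by (simp_all add: dot_cross_self inner_commute)
  then have ae: "bil H2R a e = 0" "bil H2R a1 e = 0" by (simp_all add: e_def)
  have a2e: "bil H2R a2 e \<ge> 0"
    using s by (auto simp: e_def sg_def divide_nonpos_pos)
  have fr: "frame H2R a e" using u(1) ee ae(1) by (simp add: frame_def)
  obtain r where r: "r > 0" "cosh (sqrt (t\<^sup>2 + r\<^sup>2)) < cosh t * cosh r"
    using cosh_sqrt_less[OF t0] by blast
  define p where "p = turn H2R a e r"
  have p: "p \<in> unit_points H2R" unfolding p_def by (rule turn_unit_points[OF fr])
  then have pp: "p \<in> points H2R" by (rule unit_points_subset)
  have "ang H2R x p = r"
    using r(1) p bil_turn[OF fr, of 0 r]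
    by (intro ang_unique) (auto simp: a_def[symmetric] p_def)
  have c1: "cosh (ang H2R y p) = cosh t * cosh r"
    using cosX_ang[OF pts(2) pp] ae ch p bil_commute[of H2R a a1]
    by (simp add: cosX_def flip: a1_def) (simp add: p_def turn_def cosX_def)
  have c2: "cosh (ang H2R z p) \<ge> cosh t * cosh r"
    using cosX_ang[OF pts(3) pp] a2e ch p bil_commute[of H2R a a2] r(1)
    by (simp add: cosX_def flip: a2_def) (simp add: p_def turn_def cosX_def)
  have nn: "0 \<le> ang H2R y p" "0 \<le> ang H2R z p" using ang_nonneg pts pp by blast+
  \<comment> \<open>So \<open>y\<close> gives the smaller of the two squares, and the identity
    bounds it by t^2 + r^2, against the choice of \<open>r\<close>.\<close>
  have "ang H2R y p \<le> ang H2R z p"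
    using c1 c2 cosh_real_nonneg_le_iff[OF nn] by linarith
  then have "(ang H2R y p)\<^sup>2 \<le> (ang H2R z p)\<^sup>2" using nn by (intro power_mono)
  then have "(ang H2R y p)\<^sup>2 \<le> t\<^sup>2 + r\<^sup>2"
    using par[OF pp] \<open>ang H2R x p = r\<close> by simp
  then have "ang H2R y p \<le> sqrt (t\<^sup>2 + r\<^sup>2)" by (rule real_le_rsqrt)
  then have "cosh t * cosh r \<le> cosh (sqrt (t\<^sup>2 + r\<^sup>2))"
    using cosh_real_nonneg_le_iff[OF nn(1), of "sqrt (t\<^sup>2 + r\<^sup>2)"] c1 by simp
  then show False using r(2) by simp
qed

text \<open>The images of p and of its shifts by s and -s satisfy the median identity with every
  point, by surjectivity. Removing the contribution of the heights leaves an identity in the base,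
  where rigidity makes the displacement zero.\<close>

lemma rho_bij_fibre:
  assumes f: "rho_bij X f" and p: "p \<in> points X"
  shows "unit X (f (exp s *\<^sub>R p)) = unit X (f p)"
proof -
  define x y z where "x = f p" and "y = f (exp s *\<^sub>R p)" and "z = f (exp (- s) *\<^sub>R p)"
  have pp: "exp r *\<^sub>R p \<in> points X" for r using p by (simp add: points_scale)
  have pts: "x \<in> points X" "y \<in> points X" "z \<in> points X"
    unfolding x_def y_def z_def using rho_bij_in[OF f] p pp by blast+
  have par: "(rho X y q)\<^sup>2 + (rho X z q)\<^sup>2 = 2 * s\<^sup>2 + 2 * (rho X x q)\<^sup>2" if q: "q \<in> points X" for q
  proof -
    obtain q' where q': "q' \<in> points X" "f q' = q" using rho_bij_surj[OF f q] by blast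
    show ?thesis
      using fibre_parallelogram[OF p, of s q'] rho_bij_rho[OF f pp q'(1)] rho_bij_rho[OF f p q'(1)]
      by (simp add: x_def y_def z_def q'(2))
  qed
  have dist: "(rho X p (exp r *\<^sub>R p))\<^sup>2 = r\<^sup>2" for r
    using ang_eq_0_iff[OF p p] height_exp[OF p] ang_exp[OF p, of r p]
    by (simp add: rho_square ang_commute[of X p "exp r *\<^sub>R p"])
  have d: "(rho X x y)\<^sup>2 = s\<^sup>2" "(rho X x z)\<^sup>2 = s\<^sup>2"
    using dist[of s] dist[of "- s"] rho_bij_rho[OF f p pp] by (simp_all add: x_def y_def z_def)
  define h1 h2 where "h1 = height X y - height X x" and "h2 = height X z - height X x"
  \<comment> \<open>The identity at \<open>x\<close> and at its shift by 1 along the fibre differ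
    only in terms linear in the heights.\<close>
  have "h1 + h2 = 0"
  proof -
    have e: "exp 1 *\<^sub>R x \<in> points X" using pts by (simp add: points_scale)
    have a: "ang X y (exp 1 *\<^sub>R x) = ang X y x" "ang X z (exp 1 *\<^sub>R x) = ang X z x"
      "ang X x (exp 1 *\<^sub>R x) = ang X x x"
      using ang_exp[OF pts(1), of 1] by (simp_all add: ang_commute)
    have hh: "height X y = h1 + height X x" "height X z = h2 + height X x"
      by (simp_all add: h1_def h2_def)
    show ?thesis
      using par[OF pts(1)] par[OF e] unfolding rho_square a height_exp[OF pts(1)] hh
      by (simp add: power2_eq_square algebra_simps)
  qed
  then have h2: "h2 = - h1" by simp
  define t where "t = ang X x y"
  have t1: "t\<^sup>2 = s\<^sup>2 - h1\<^sup>2"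
    using d(1) by (simp add: rho_square t_def h1_def power2_commute)
  have "(ang X x z)\<^sup>2 = s\<^sup>2 - h2\<^sup>2"
    using d(2) by (simp add: rho_square h2_def power2_commute)
  then have "(ang X x z)\<^sup>2 = t\<^sup>2" using t1 h2 by simp
  then have t2: "ang X x z = t"
    using ang_nonneg pts by (simp add: t_def power2_eq_iff_nonneg)
  \<comment> \<open>Since \<open>h2 = - h1\<close>, the heights satisfy their own median identity,
    which is subtracted.\<close>
  have par': "(ang X y q)\<^sup>2 + (ang X z q)\<^sup>2 = 2 * t\<^sup>2 + 2 * (ang X x q)\<^sup>2" if "q \<in> points X" for q
  proof -
    have "(ang X y q)\<^sup>2 + (ang X z q)\<^sup>2 + ((height X y - height X q)\<^sup>2 + (height X z - height X q)\<^sup>2)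
        = 2 * s\<^sup>2 + 2 * (ang X x q)\<^sup>2 + 2 * (height X x - height X q)\<^sup>2"
      using par[OF that] by (simp add: rho_square)
    moreover have "(height X y - height X q)\<^sup>2 + (height X z - height X q)\<^sup>2
        = 2 * (height X x - height X q)\<^sup>2 + 2 * h1\<^sup>2"
    proof -
      have e: "height X y = height X x + h1" "height X z = height X x - h1"
        using h2 by (simp_all add: h1_def h2_def)
      show ?thesis unfolding e by (simp add: power2_eq_square algebra_simps)
    qed
    ultimately show ?thesis using t1 by simp
  qed
  have "t = 0"
  proof (cases X)
    case S2R
    show ?thesis by (rule parallelogram_rigid_S2R[of x y z t]) (use pts par' S2R in auto)
  next
    case H2R
    show ?thesis
      by (rule parallelogram_rigid_H2R[of x y z t]) (use pts par' t2 t_def H2R in auto)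
  qed
  then show ?thesis
    using ang_eq_0_iff[OF pts(1,2)] by (simp add: t_def x_def y_def)
qed

text \<open>Sliding \<open>q\<close> along its fibre to the height of \<open>p\<close> turns
  \<open>rho\<close> into \<open>ang\<close>, and \<open>f\<close> keeps the fibre together, so the
  angle of the images is not affected by the slide.\<close>

lemma rho_bij_ang_le:
  assumes f: "rho_bij X f" and p: "p \<in> points X" and q: "q \<in> points X"
  shows "ang X (f p) (f q) \<le> ang X p q"
proof -
  define q' where "q' = exp (height X p - height X q) *\<^sub>R q"
  have q': "q' \<in> points X" using q by (simp add: q'_def points_scale)
  have "ang X (f p) (f q) = ang X (f p) (f q')"
    using rho_bij_fibre[OF f q] by (simp add: ang_def q'_def)
  also have "\<dots> \<le> rho X (f p) (f q')"
    by (simp add: rho_def)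
  also have "\<dots> = rho X p q'" by (rule rho_bij_rho[OF f p q'])
  also have "\<dots> = ang X p q"
    using ang_exp[OF q, of _ p] height_exp[OF q] ang_nonneg[OF p q]
    by (simp add: rho_def q'_def ang_commute[of X p])
  finally show ?thesis .
qed

lemma rho_bij_ang:
  assumes f: "rho_bij X f" and p: "p \<in> points X" and q: "q \<in> points X"
  shows "ang X (f p) (f q) = ang X p q"
proof -
  obtain g where g: "rho_bij X g" "\<And>x. x \<in> points X \<Longrightarrow> g (f x) = x"
    using rho_bij_inv[OF f] by blast
  show ?thesis
    using rho_bij_ang_le[OF f p q] rho_bij_ang_le[OF g(1) rho_bij_in[OF f p] rho_bij_in[OF f q]] g(2) p q
    by simp
qed

lemma axis_in_unit_points: "axis 1 1 \<in> unit_points X"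
proof -
  have "axis 1 1 $ 1 = (1::real)" "(axis 1 1 :: real^3) $ 2 = 0" "(axis 1 1 :: real^3) $ 3 = 0"
    by (simp_all add: axis_def)
  then show ?thesis
    by (cases X) (auto simp: unit_points_def bil_def mink_def inner_vec_def sum_3)
qed

text \<open>Height differences are preserved up to sign. The images of two reference points at
  heights 0 and 1 then fix an isometry of the line, t to c + t or c - t.\<close>

lemma rho_bij_height:
  assumes f: "rho_bij X f"
  obtains c \<sigma> where "\<sigma>\<^sup>2 = 1" "\<And>p. p \<in> points X \<Longrightarrow> height X (f p) = c + \<sigma> * height X p"
proof -
  have h: "(height X (f p) - height X (f q))\<^sup>2 = (height X p - height X q)\<^sup>2"
    if "p \<in> points X" "q \<in> points X" for p q
  proof -
    have "(rho X (f p) (f q))\<^sup>2 = (rho X p q)\<^sup>2" using rho_bij_rho[OF f that] by simp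
    then show ?thesis using rho_bij_ang[OF f that] by (simp add: rho_square)
  qed
  define o1 :: "real^3" where "o1 = axis 1 1"
  have o1: "o1 \<in> unit_points X" by (simp add: o1_def axis_in_unit_points)
  then have o: "o1 \<in> points X" "height X o1 = 0" by (simp_all add: unit_points_subset)
  have e: "exp 1 *\<^sub>R o1 \<in> points X" "height X (exp 1 *\<^sub>R o1) = 1"
    using o by (simp_all add: points_scale height_exp)
  define c where "c = height X (f o1)"
  define \<sigma> where "\<sigma> = height X (f (exp 1 *\<^sub>R o1)) - c"
  have s: "\<sigma>\<^sup>2 = 1" using h[OF e(1) o(1)] e o by (simp add: \<sigma>_def c_def)
  have "height X (f p) = c + \<sigma> * height X p" if p: "p \<in> points X" for p
  proof -
    define y t where "y = height X (f p) - c" and "t = height X p"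
    have "y\<^sup>2 = t\<^sup>2" using h[OF p o(1)] o by (simp add: y_def t_def c_def)
    moreover have "(y - \<sigma>)\<^sup>2 = (t - 1)\<^sup>2"
      using h[OF p e(1)] e by (simp add: y_def t_def \<sigma>_def)
    ultimately have "\<sigma> * y = t" using s by (simp add: power2_eq_square algebra_simps)
    then have "y = \<sigma> * t" using s by (metis mult.assoc mult_1 power2_eq_square)
    then show ?thesis by (simp add: y_def t_def)
  qed
  with s show thesis using that by blast
qed

lemma bil_points_eq_0:
  assumes "\<And>y. y \<in> unit_points X \<Longrightarrow> bil X z y = 0"
  shows "z = 0"
proof -
  have *: "bil X z y = 0" if y: "y \<in> points X" for y
  proof -
    have "bil X z (exp (height X y) *\<^sub>R unit X y) = 0"
      using assms[OF unit_in_unit_points[OF y]] by simp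
    then show ?thesis using scale_unit[OF y] by simp
  qed
  show ?thesis
  proof (cases X)
    case S2R
    show ?thesis using *[of z] S2R by (cases "z = 0") (auto simp: bil_def)
  next
    case H2R
    have "bil H2R z (vector [2, 0, 0]) = 0" "bil H2R z (vector [2, 1, 0]) = 0"
      "bil H2R z (vector [2, 0, 1]) = 0"
      using * H2R by auto
    then show ?thesis by (simp add: bil_def mink_def vec_eq_iff forall_3)
  qed
qed

text \<open>The map induced on the base preserves \<open>bil\<close>, so it acts linearly on frames.
  The base speed \<open>k\<close> is therefore unchanged, while the slope may change sign.\<close>

lemma rho_bij_gcurve:
  assumes f: "rho_bij X f" and fr: "frame X a b"
  obtains a' b' c' \<sigma> where "frame X a' b'" "\<sigma>\<^sup>2 = 1"
    "\<And>t. f (gcurve X a b c s k t) = gcurve X a' b' c' (\<sigma> * s) k t"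
proof -
  obtain c0 \<sigma> where s: "\<sigma>\<^sup>2 = 1" and
    h: "\<And>p. p \<in> points X \<Longrightarrow> height X (f p) = c0 + \<sigma> * height X p"
    using rho_bij_height[OF f] by blast
  define \<phi> where "\<phi> = (\<lambda>x. unit X (f x))"
  have pres: "bil X (\<phi> x) (\<phi> y) = bil X x y" if "x \<in> unit_points X" "y \<in> unit_points X" for x y
  proof -
    have xy: "x \<in> points X" "y \<in> points X" using that by (simp_all add: unit_points_subset)
    have "bil X (\<phi> x) (\<phi> y) = cosX X (ang X (f x) (f y))"
      using cosX_ang[OF rho_bij_in[OF f xy(1)] rho_bij_in[OF f xy(2)]] by (simp add: \<phi>_def)
    also have "\<dots> = bil X x y"
      using rho_bij_ang[OF f xy] cosX_ang[OF xy] that by simp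
    finally show ?thesis .
  qed
  have phi: "\<phi> x \<in> unit_points X" if "x \<in> unit_points X" for x
    unfolding \<phi>_def using that rho_bij_in[OF f] unit_in_unit_points unit_points_subset by blast
  \<comment> \<open>The induced map is onto the unit points, so its values suffice to test for zero.
    This replaces a linear extension of \<open>\<phi>\<close>.\<close>
  have zero: "z = 0" if "\<And>y. y \<in> unit_points X \<Longrightarrow> bil X z (\<phi> y) = 0" for z
  proof (rule bil_points_eq_0)
    fix y assume y: "y \<in> unit_points X"
    obtain p where p: "p \<in> points X" "f p = y"
      using rho_bij_surj[OF f unit_points_subset[OF y]] by blast
    have "\<phi> (unit X p) = unit X (f p)"
    proof -
      have "ang X (f (unit X p)) (f p) = ang X (unit X p) p"
        using p unit_in_unit_points unit_points_subset by (intro rho_bij_ang[OF f]) blast+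
      also have "\<dots> = 0" using ang_unit[OF p(1) p(1)] ang_eq_0_iff[OF p(1) p(1)] by simp
      finally show ?thesis unfolding \<phi>_def
        using ang_eq_0_iff rho_bij_in[OF f] p(1) unit_in_unit_points unit_points_subset by blast
    qed
    then have "\<phi> (unit X p) = y" using p y by simp
    then show "bil X z y = 0" using that[OF unit_in_unit_points[OF p(1)]] by simp
  qed
  \<comment> \<open>The parameter 1 is less than pi, so the point there is independent of
    \<open>a\<close> and its image determines \<open>b'\<close>.\<close>
  have w1: "w X 1 \<noteq> 0"
    using sin_gt_zero[of 1] pi_gt3 by (cases X) auto
  define x1 a' b' where "x1 = turn X a b 1" and "a' = \<phi> a"
    and "b' = inverse (w X 1) *\<^sub>R (\<phi> x1 - cosX X 1 *\<^sub>R a')"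
  have a: "a \<in> unit_points X" using fr by (simp add: frame_def)
  have x1: "x1 \<in> unit_points X" unfolding x1_def by (rule turn_unit_points[OF fr])
  have bphi: "bil X b' (\<phi> y) = bil X b y" if y: "y \<in> unit_points X" for y
  proof -
    have "bil X b' (\<phi> y) = inverse (w X 1) * (bil X x1 y - cosX X 1 * bil X a y)"
      by (simp add: b'_def a'_def pres[OF x1 y] pres[OF a y])
    also have "\<dots> = inverse (w X 1) * (w X 1 * bil X b y)"
      by (simp add: x1_def turn_def)
    finally show ?thesis using w1 by simp
  qed
  have ba: "bil X b' a' = 0" using bphi[OF a] frame_bil[OF fr] by (simp add: a'_def)
  have "bil X b' b' = inverse (w X 1) * (bil X b' (\<phi> x1) - cosX X 1 * bil X b' a')"
    unfolding b'_def[THEN arg_cong, of "bil X b'"] by simp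
  also have "\<dots> = inverse (w X 1) * (w X 1 * eps X)"
    using bphi[OF x1] ba frame_bil[OF fr] by (simp add: x1_def turn_def)
  finally have bb: "bil X b' b' = eps X" using w1 by simp
  have fr': "frame X a' b'"
    using phi[OF a] bb ba bil_commute[of X a' b'] by (simp add: frame_def a'_def)
  have turn: "\<phi> (turn X a b t) = turn X a' b' t" for t
  proof -
    have "\<phi> (turn X a b t) - turn X a' b' t = 0"
    proof (rule zero)
      fix y assume y: "y \<in> unit_points X"
      show "bil X (\<phi> (turn X a b t) - turn X a' b' t) (\<phi> y) = 0"
        using pres[OF turn_unit_points[OF fr] y] bphi[OF y] pres[OF a y]
        by (simp add: turn_def a'_def)
    qed
    then show ?thesis by simp
  qed
  have "f (gcurve X a b c s k t) = gcurve X a' b' (c0 + \<sigma> * c) (\<sigma> * s) k t" for t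
  proof -
    let ?g = "gcurve X a b c s k t"
    have g: "?g \<in> points X" by (rule gcurve_in_points[OF fr])
    have "f ?g = exp (height X (f ?g)) *\<^sub>R unit X (f ?g)"
      by (rule scale_unit[OF rho_bij_in[OF f g]])
    moreover have "height X (f ?g) = c0 + \<sigma> * c + \<sigma> * s * t"
      using h[OF g] height_gcurve[OF fr] by (simp add: algebra_simps)
    moreover have "unit X (f ?g) = turn X a' b' (k * t)"
      using rho_bij_fibre[OF f unit_points_subset[OF turn_unit_points[OF fr]], of "c + s * t" "k * t"] turn
      by (simp add: gcurve_def \<phi>_def)
    ultimately show ?thesis by (simp add: gcurve_def)
  qed
  with fr' s show thesis using that by blast
qed

section \<open>Geodesics and the geodesic distance\<close>

lemma base_geodesic_gcurve:
  obtains b where "frame X (axis 1 1) b"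
    "\<And>t. base_geodesic X u v t = gcurve X (axis 1 1) b 0 (sin v) (cos v) t"
proof -
  define b :: "real^3" where "b = vector [0, cos u, sin u]"
  have e: "axis 1 1 = (vector [1, 0, 0] :: real^3)"
    by (simp add: vec_eq_iff forall_3 axis_def)
  have "cos u * cos u + sin u * sin u = 1" by (metis power2_eq_square sin_cos_squared_add2)
  then have "cos u * cos u + sin u * sin u = 1" "- (cos u * cos u) - sin u * sin u = - 1"
    by linarith+
  then have "frame X (axis 1 1) b"
    using axis_in_unit_points[of X]
    by (cases X) (auto simp: frame_def e b_def bil_def mink_def eps_def inner_vec_def sum_3)
  moreover have "base_geodesic X u v t = gcurve X (axis 1 1) b 0 (sin v) (cos v) t" for t
    by (cases X) (simp_all add: gcurve_def turn_def e b_def cosX_def vec_eq_iff forall_3 mult.commute)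
  ultimately show thesis using that by blast
qed

lemma has_param_gcurve:
  assumes "has_param X \<gamma> v"
  obtains a b c s where "frame X a b" "s\<^sup>2 + (cos v)\<^sup>2 = 1" "cos v \<ge> 0" "\<gamma> = gcurve X a b c s (cos v)"
proof -
  obtain f u where v: "- (pi/2) \<le> v" "v \<le> pi/2" and f: "orientation_preserving_isometry X f"
    and g: "\<And>t. \<gamma> t = f (base_geodesic X u v t)"
    using assms unfolding has_param_def by blast
  obtain b where b: "frame X (axis 1 1) b"
    "\<And>t. base_geodesic X u v t = gcurve X (axis 1 1) b 0 (sin v) (cos v) t"
    using base_geodesic_gcurve by metis
  obtain a' b' c' \<sigma> where r: "frame X a' b'" "\<sigma>\<^sup>2 = 1"
    "\<And>t. f (gcurve X (axis 1 1) b 0 (sin v) (cos v) t) = gcurve X a' b' c' (\<sigma> * sin v) (cos v) t"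
    using rho_bij_gcurve[OF isometry_rho_bij[OF f] b(1)] by metis
  have "cos v \<ge> 0" using v cos_ge_zero by simp
  moreover have "(\<sigma> * sin v)\<^sup>2 + (cos v)\<^sup>2 = 1" using r(2) by (simp add: power_mult_distrib)
  moreover have "\<gamma> = gcurve X a' b' c' (\<sigma> * sin v) (cos v)"
    using g b(2) r(3) by (auto simp: fun_eq_iff)
  ultimately show thesis using that r(1) by blast
qed

text \<open>Whatever representative \<open>v_param\<close> selects, its cosine is the base speed in
  some model form of the curve; later arguments use nothing else about the choice.\<close>

lemma geodesic_gcurve:
  assumes "geodesic X \<gamma>"
  obtains a b c s where "frame X a b" "s\<^sup>2 + (cos (v_param X \<gamma>))\<^sup>2 = 1" "cos (v_param X \<gamma>) \<ge> 0"
    "\<gamma> = gcurve X a b c s (cos (v_param X \<gamma>))"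
proof -
  have "has_param X \<gamma> (v_param X \<gamma>)"
    using assms unfolding geodesic_def v_param_def by (rule someI_ex)
  then show thesis using that has_param_gcurve by metis
qed

lemma geodesic_rho_le:
  assumes "geodesic X \<gamma>"
  shows "rho X (\<gamma> 0) (\<gamma> t) \<le> \<bar>t\<bar>"
proof -
  obtain a b c s k where fr: "frame X a b" and sk: "s\<^sup>2 + k\<^sup>2 = 1" "k \<ge> 0" and g: "\<gamma> = gcurve X a b c s k"
    using geodesic_gcurve[OF assms] by metis
  have pts: "\<gamma> r \<in> points X" for r unfolding g by (rule gcurve_in_points[OF fr])
  have "ang X (\<gamma> 0) (\<gamma> t) \<le> \<bar>k * t\<bar>"
  proof (cases "X = S2R \<longrightarrow> \<bar>k * t\<bar> \<le> pi")
    case True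
    then show ?thesis using ang_gcurve[OF fr, of k 0 t] by (simp add: g)
  next
    case False
    then show ?thesis using ang_le_pi pts by (metis linear order_trans)
  qed
  then have "(ang X (\<gamma> 0) (\<gamma> t))\<^sup>2 \<le> \<bar>k * t\<bar>\<^sup>2" using ang_nonneg pts by (intro power_mono) auto
  then have "(rho X (\<gamma> 0) (\<gamma> t))\<^sup>2 \<le> (s * t)\<^sup>2 + (k * t)\<^sup>2"
    using height_gcurve[OF fr, of c s k 0] by (simp add: rho_square g height_gcurve[OF fr])
  also have "\<dots> = (s\<^sup>2 + k\<^sup>2) * t\<^sup>2" by algebra
  finally show ?thesis using sk by (simp add: abs_le_square_iff[symmetric])
qed

section \<open>Transitivity of the isometry group through linear maps\<close>

lemma linear_similarity_isometry:
  assumes lin: "linear f" and det: "det (matrix f) > 0" and r: "r > 0"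
    and bil: "\<And>x y. bil X (f x) (f y) = r * bil X x y"
    and bij: "bij_betw f (points X) (points X)"
  shows "orientation_preserving_isometry X f"
proof -
  \<comment> \<open>The metric is homogeneous of degree 0: dilations are translations along the
    fibres, so the factor \<open>r\<close> cancels.\<close>
  have "ds2 X (f p) (f u) = ds2 X p u" for p u
    unfolding ds2_eq bil using r by simp
  moreover have "(f has_derivative f) (at p)" for p
    using lin by (simp add: linear_conv_bounded_linear bounded_linear_imp_has_derivative)
  ultimately show ?thesis
    unfolding orientation_preserving_isometry_def using bij det
    by (intro conjI exI[of _ "\<lambda>_. f"]) auto
qed

text \<open>For $a^2 = 1 + b^2 + c^2$ this is the Lorentz boost taking $(1,0,0)$ to $(a,b,c)$, scaled by $r$.\<close>

definition boost :: "real \<Rightarrow> real \<Rightarrow> real \<Rightarrow> real \<Rightarrow> real^3 \<Rightarrow> real^3" where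
  "boost r a b c x = (let m = b * x$2 + c * x$3 in
     r *\<^sub>R vector [a * x$1 + m, b * x$1 + x$2 + b * m / (1 + a), c * x$1 + x$3 + c * m / (1 + a)])"

lemma boost_linear: "linear (boost r a b c)"
  by (rule linearI) (simp_all add: boost_def Let_def vec_eq_iff forall_3 algebra_simps add_divide_distrib)

text \<open>The reciprocal of 1 + a is treated as a variable \<open>k\<close> with the relation k (1
  + a) = 1, so that only a polynomial identity modulo two relations remains. The next lemmas on
  boosts use the same device.\<close>

lemma boost_bil:
  assumes a: "a > 0" "a\<^sup>2 = 1 + b\<^sup>2 + c\<^sup>2"
  shows "bil H2R (boost r a b c x) (boost r a b c y) = r\<^sup>2 * bil H2R x y"
proof -
  define k where "k = 1 / (1 + a)"
  have k: "k * (1 + a) = 1" using a by (simp add: k_def)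
  have d: "z / (1 + a) = z * k" for z by (simp add: k_def)
  show ?thesis
    using k a(2) unfolding boost_def Let_def d
    by (simp add: bil_def mink_def) algebra
qed

lemma boost_inverse:
  assumes a: "a > 0" "a\<^sup>2 = 1 + b\<^sup>2 + c\<^sup>2" and r: "r > 0"
  shows "boost (1 / r) a (- b) (- c) (boost r a b c x) = x"
proof -
  define k where "k = 1 / (1 + a)"
  have k: "k * (1 + a) = 1" using a by (simp add: k_def)
  have d: "z / (1 + a) = z * k" for z by (simp add: k_def)
  have "boost 1 a (- b) (- c) (boost 1 a b c x) = x"
    unfolding boost_def Let_def d
    apply (simp add: vec_eq_iff forall_3)
    using k a(2) apply (intro conjI)
      apply algebra+
    done
  moreover have "boost r a b c x = r *\<^sub>R boost 1 a b c x" "boost (1 / r) a (- b) (- c) y = (1 / r) *\<^sub>R boost 1 a (- b) (- c) y" for y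
    by (simp_all add: boost_def Let_def)
  ultimately show ?thesis
    using r linear_scale[OF boost_linear, of 1 a "- b" "- c" r] by simp
qed

lemma boost_points:
  assumes a: "a > 0" "a\<^sup>2 = 1 + b\<^sup>2 + c\<^sup>2" and r: "r > 0" and x: "x \<in> points H2R"
  shows "boost r a b c x \<in> points H2R"
proof -
  have "vector [a, - b, - c] \<in> points H2R" using a by simp
  from points_H2R_gram(3)[OF this x] have "a * x$1 + (b * x$2 + c * x$3) > 0"
    by (simp add: bil_def mink_def)
  then have "boost r a b c x $ 1 > 0" using r by (simp add: boost_def Let_def)
  moreover have "bil H2R (boost r a b c x) (boost r a b c x) > 0"
    unfolding boost_bil[OF a] using bil_pos[OF x] r by simp
  ultimately show ?thesis by (simp add: bil_def mink_def power2_eq_square)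
qed

lemma boost_det:
  assumes a: "a > 0" "a\<^sup>2 = 1 + b\<^sup>2 + c\<^sup>2"
  shows "det (matrix (boost r a b c)) = r ^ 3"
proof -
  define k where "k = 1 / (1 + a)"
  have k: "k * (1 + a) = 1" using a by (simp add: k_def)
  have d: "z / (1 + a) = z * k" for z by (simp add: k_def)
  show ?thesis
    unfolding boost_def Let_def d
    apply (simp add: det_3 matrix_def axis_def)
    using k a(2) by algebra
qed

lemma boost_isometry:
  assumes a: "a > 0" "a\<^sup>2 = 1 + b\<^sup>2 + c\<^sup>2" and r: "r > 0"
  shows "orientation_preserving_isometry H2R (boost r a b c)"
proof (rule linear_similarity_isometry[OF boost_linear, of _ _ _ _ "r\<^sup>2"])
  show "bij_betw (boost r a b c) (points H2R) (points H2R)"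
  proof (rule bij_betwI[where g = "boost (1 / r) a (- b) (- c)"])
    show "boost r a b c \<in> points H2R \<rightarrow> points H2R" using boost_points[OF a r] by blast
    show "boost (1 / r) a (- b) (- c) \<in> points H2R \<rightarrow> points H2R"
      using boost_points[of a "- b" "- c" "1 / r"] a r by (simp add: Pi_iff)
    show "boost (1 / r) a (- b) (- c) (boost r a b c x) = x" for x by (rule boost_inverse[OF a r])
    show "boost r a b c (boost (1 / r) a (- b) (- c) x) = x" for x
      using boost_inverse[of a "- b" "- c" "1 / r" x] a r by simp
  qed
qed (use boost_det[OF a] boost_bil[OF a] r in auto)

text \<open>A rotation or a boost carries the base point to the direction of \<open>P\<close>; a
  dilation then adjusts the height.\<close>

lemma isometry_transitive:
  assumes P: "P \<in> points X"
  obtains f where "orientation_preserving_isometry X f" "f (axis 1 1) = P"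
proof (cases X)
  case S2R
  have n: "norm P > 0" using P S2R by simp
  have "norm (axis 1 1 :: real^3) = norm (P /\<^sub>R norm P)" using n by (simp add: norm_axis_1)
  then obtain h where h: "orthogonal_transformation h" "det (matrix h) = 1"
    "h (axis 1 1) = P /\<^sub>R norm P"
    using rotation_exists[of "axis 1 1" "P /\<^sub>R norm P"] by auto
  define f where "f = (\<lambda>x. norm P *\<^sub>R h x)"
  have lh: "linear h" using h(1) by (simp add: orthogonal_transformation_def)
  have lin: "linear f" unfolding f_def using lh by (rule linear_compose_scale_right)
  have "matrix f = norm P *\<^sub>R matrix h" by (simp add: f_def matrix_def vec_eq_iff)
  then have "det (matrix f) = norm P ^ 3 * det (matrix h)"
    by (simp add: det_3 power3_eq_cube algebra_simps)
  then have "det (matrix f) > 0" using h(2) n by simp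
  moreover have "bil X (f x) (f y) = (norm P)\<^sup>2 * bil X x y" for x y
    using h(1) S2R by (simp add: f_def bil_def orthogonal_transformation_def power2_eq_square)
  moreover have "bij_betw f (points X) (points X)"
  proof -
    have hb: "bij h" using h(1) by (rule orthogonal_transformation_bij)
    have nz: "h x = 0 \<longleftrightarrow> x = 0" for x
      using hb linear_0[OF lh] by (metis bij_def injD)
    have inj: "inj_on f (points X)"
      using hb n by (auto simp: f_def inj_on_def bij_def inj_def)
    have "f ` points X = points X"
    proof
      have "f x \<noteq> 0" if "x \<noteq> 0" for x using n nz[of x] that by (simp add: f_def)
      then show "f ` points X \<subseteq> points X" using S2R by force
      show "points X \<subseteq> f ` points X"
      proof
        fix y assume y: "y \<in> points X"
        obtain x where x: "h x = y /\<^sub>R norm P" using bij_is_surj[OF hb] by (metis surjD)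
        then have "f x = y" using n by (simp add: f_def)
        moreover have "x \<noteq> 0"
        proof
          assume "x = 0"
          then have "f x = 0" by (simp add: f_def linear_0[OF lh])
          then show False using \<open>f x = y\<close> y points_nonzero by blast
        qed
        then have "x \<in> points X" using S2R by simp
        ultimately show "y \<in> f ` points X" by blast
      qed
    qed
    then show ?thesis using inj by (simp add: bij_betw_def)
  qed
  ultimately have "orientation_preserving_isometry X f"
    using n by (intro linear_similarity_isometry[OF lin, of "(norm P)\<^sup>2"]) auto
  moreover have "f (axis 1 1) = P" using h(3) n by (simp add: f_def)
  ultimately show thesis using that by blast
next
  case H2R
  define u where "u = unit X P"
  have u: "u \<in> unit_points X" using unit_in_unit_points[OF P] by (simp add: u_def)
  then have a: "u$1 > 0" "(u$1)\<^sup>2 = 1 + (u$2)\<^sup>2 + (u$3)\<^sup>2"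
    using H2R by (auto simp: unit_points_def bil_def mink_def power2_eq_square)
  define f where "f = boost (exp (height X P)) (u$1) (u$2) (u$3)"
  have "f (axis 1 1) = exp (height X P) *\<^sub>R u"
    by (simp add: f_def boost_def Let_def axis_def vec_eq_iff forall_3)
  also have "\<dots> = P" using scale_unit[OF P] by (simp add: u_def)
  finally show thesis using that boost_isometry[OF a, of "exp (height X P)"] H2R f_def by auto
qed

text \<open>An isometry moves the start to (1,0,0). There the parameters are read off: u from the
  tangent direction in the base, v from the ratio of height to base distance.\<close>

lemma geodesic_exists:
  assumes P: "P \<in> points X" and Q: "Q \<in> points X"
  obtains \<gamma> where "geodesic X \<gamma>" "\<gamma> 0 = P" "\<gamma> (rho X P Q) = Q"
proof -
  define e :: "real^3" where "e = axis 1 1"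
  have e: "e \<in> unit_points X" using axis_in_unit_points by (simp add: e_def)
  then have eX: "e \<in> points X" by (rule unit_points_subset)
  obtain f where f: "orientation_preserving_isometry X f" "f e = P"
    using isometry_transitive[OF P] e_def by metis
  obtain q where q: "q \<in> points X" "f q = Q"
    using rho_bij_surj[OF isometry_rho_bij[OF f(1)] Q] by blast
  define L h k where "L = rho X e q" and "h = height X q" and "k = ang X e q"
  have L: "rho X P Q = L" using isometry_rho[OF f(1) eX q(1)] f q by (simp add: L_def)
  have L2: "L\<^sup>2 = h\<^sup>2 + k\<^sup>2" using e by (simp add: L_def rho_square h_def k_def)
  have k0: "k \<ge> 0" using ang_nonneg[OF eX q(1)] by (simp add: k_def)
  have L0: "L \<ge> 0" by (simp add: L_def)
  obtain a b where fr: "frame X a b" and g: "gcurve X a b (height X e) (height X q - height X e) k 0 = e"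
    "gcurve X a b (height X e) (height X q - height X e) k 1 = q"
    using gcurve_exists[OF eX q(1)] k_def by metis
  have a: "a = e" using g(1) e by simp
  have qe: "q = gcurve X e b 0 h k 1" using g(2) e a by (simp add: h_def)
  have b: "b$1 = 0" "(b$2)\<^sup>2 + (b$3)\<^sup>2 = 1"
  proof -
    have e1: "e$1 = 1" "e$2 = 0" "e$3 = 0" by (simp_all add: e_def axis_def)
    show b1: "b$1 = 0"
      using frame_bil(3)[OF fr] a e1 by (cases X) (simp_all add: bil_def mink_def inner_vec_def sum_3)
    show "(b$2)\<^sup>2 + (b$3)\<^sup>2 = 1"
      using frame_bil(2)[OF fr] b1
      by (cases X) (simp_all add: bil_def eps_def mink_def inner_vec_def sum_3 power2_eq_square)
  qed
  \<comment> \<open>The argument of this unit complex number provides u in the half-open range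
    demanded by \<open>has_param\<close>.\<close>
  define z where "z = Complex (b$2) (b$3)"
  define u where "u = Arg z"
  have z: "cmod z = 1" using b(2) by (simp add: z_def cmod_def)
  have "z \<noteq> 0" using z by auto
  then have "z = cis u" using z cis_Arg[of z] by (simp add: u_def sgn_div_norm)
  then have cu: "cos u = b$2" "sin u = b$3" by (simp_all add: z_def complex_eq_iff)
  have u: "- pi < u" "u \<le> pi" using Arg_bounded[of z] by (simp_all add: u_def)
  have beq: "b = vector [0, cos u, sin u]" using b(1) cu by (simp add: vec_eq_iff forall_3)
  have ee: "e = vector [1, 0, 0]" by (simp add: e_def vec_eq_iff forall_3 axis_def)
  \<comment> \<open>Polar coordinates of the pair (k, h). For coinciding points the angle is
    arbitrary and 0 is taken.\<close>
  have "\<exists>v. - (pi/2) \<le> v \<and> v \<le> pi/2 \<and> L * sin v = h \<and> L * cos v = k"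
  proof (cases "L = 0")
    case True
    then have "h = 0" "k = 0" using L2 by (simp_all add: sum_power2_eq_zero_iff)
    then show ?thesis using True by (intro exI[of _ 0]) auto
  next
    case False
    define v where "v = arcsin (h / L)"
    have "\<bar>h\<bar> \<le> \<bar>L\<bar>" using L2 by (simp add: abs_le_square_iff)
    then have hl: "\<bar>h / L\<bar> \<le> 1" using False by simp
    then have hl': "-1 \<le> h / L" "h / L \<le> 1"
      using abs_le_D1[OF hl] abs_le_D2[OF hl] by linarith+
    have "sin v = h / L" using hl' by (simp add: v_def)
    then have s: "L * sin v = h" using False by simp
    have cv: "cos v \<ge> 0" using arcsin_bounded[OF hl'] unfolding v_def by (intro cos_ge_zero) auto
    have "(L * cos v)\<^sup>2 = L\<^sup>2 - (L * sin v)\<^sup>2"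
      by (simp add: power_mult_distrib cos_squared_eq right_diff_distrib)
    also have "\<dots> = k\<^sup>2" unfolding s L2 by simp
    finally have "L * cos v = k" using cv L0 k0 by (simp add: power2_eq_iff_nonneg)
    then show ?thesis using s arcsin_bounded[OF hl'] by (intro exI[of _ v]) (auto simp: v_def)
  qed
  then obtain v where v: "- (pi/2) \<le> v" "v \<le> pi/2" "L * sin v = h" "L * cos v = k" by blast
  have "base_geodesic X u v L = q"
    using v(3,4) unfolding qe beq ee
    by (cases X) (simp_all add: gcurve_def turn_def cosX_def vec_eq_iff forall_3 mult.commute)
  moreover have "base_geodesic X u v 0 = e"
    by (cases X) (simp_all add: ee vec_eq_iff forall_3)
  moreover have "geodesic X (\<lambda>t. f (base_geodesic X u v t))"
    unfolding geodesic_def has_param_def using v(1,2) f(1) u by blast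
  ultimately show thesis using that f(2) q(2) L by metis
qed

text \<open>Every geodesic has unit speed, so none is shorter than \<open>rho\<close>, and the one
  just constructed attains it; the infimum is a minimum.\<close>

lemma gdist_eq_rho:
  assumes "P \<in> points X" "Q \<in> points X"
  shows "gdist X P Q = rho X P Q"
proof -
  obtain \<gamma> where g: "geodesic X \<gamma>" "\<gamma> 0 = P" "\<gamma> (rho X P Q) = Q"
    using geodesic_exists[OF assms] by metis
  show ?thesis
    unfolding gdist_def
  proof (rule cInf_eq_minimum)
    show "rho X P Q \<in> {\<tau>. 0 \<le> \<tau> \<and> (\<exists>\<gamma>. geodesic X \<gamma> \<and> \<gamma> 0 = P \<and> \<gamma> \<tau> = Q)}"
      using g by auto
    fix t assume "t \<in> {\<tau>. 0 \<le> \<tau> \<and> (\<exists>\<gamma>. geodesic X \<gamma> \<and> \<gamma> 0 = P \<and> \<gamma> \<tau> = Q)}"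
    then obtain \<delta> where "0 \<le> t" "geodesic X \<delta>" "\<delta> 0 = P" "\<delta> t = Q" by auto
    then show "rho X P Q \<le> t" using geodesic_rho_le[of X \<delta> t] by simp
  qed
qed

section \<open>Sides, cevians and the theorem\<close>

lemma geodesic_in_points: "geodesic X \<gamma> \<Longrightarrow> \<gamma> t \<in> points X"
  by (metis geodesic_gcurve gcurve_in_points)

lemma geodesic_continuous: "geodesic X \<gamma> \<Longrightarrow> continuous_on A \<gamma>"
proof -
  assume "geodesic X \<gamma>"
  then obtain a b c s where g: "frame X a b" "\<gamma> = gcurve X a b c s (cos (v_param X \<gamma>))"
    by (rule geodesic_gcurve)
  have "isCont \<gamma> t" for t
    by (subst g(2), rule gcurve_deriv[OF g(1)]) (rule has_vector_derivative_continuous)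
  then show ?thesis by (simp add: continuous_at_imp_continuous_on)
qed

section \<open>Geodesics and planes through the centre\<close>

lemma frame_cross: "frame X a b \<Longrightarrow> cross3 a b \<noteq> 0"
proof
  assume fr: "frame X a b" and "cross3 a b = 0"
  have "a \<noteq> 0" using frame_bil(1)[OF fr] by auto
  then obtain c where c: "b = c *\<^sub>R a"
    using \<open>cross3 a b = 0\<close> by (auto simp: cross_eq_0 collinear_lemma)
  then have "c = 0" using frame_bil(1,3)[OF fr] by simp
  then show False using frame_bil(2)[OF fr] c by (cases X) (auto simp: eps_def)
qed

lemma cross3_turn: "cross3 (turn X a b s) (turn X a b t) = w X (t - s) *\<^sub>R cross3 a b"
  by (simp add: turn_def w_diff cross_add_left cross_add_right cross_skew[of b a] algebra_simps)

lemma cross3_gcurve: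
  "cross3 (gcurve X a b c s k p) (gcurve X a b c s k q)
    = (exp (c + s * p) * exp (c + s * q) * w X (k * q - k * p)) *\<^sub>R cross3 a b"
  by (simp add: gcurve_def cross3_turn)

lemma span2_normal:
  assumes "n \<bullet> a = 0" "n \<bullet> b = 0" "n \<bullet> y = 0" "n \<noteq> 0" "cross3 a b \<noteq> 0"
  obtains \<alpha> \<beta> where "y = \<alpha> *\<^sub>R a + \<beta> *\<^sub>R b"
proof -
  define m where "m = cross3 a b"
  have "cross3 n m = 0"
    unfolding m_def using assms(1,2) by (simp add: cross3_def vec_eq_iff forall_3 inner_vec_def sum_3) algebra
  then obtain d where d: "m = d *\<^sub>R n"
    using assms(4) by (auto simp: cross_eq_0 collinear_lemma)
  have my: "m \<bullet> y = 0" using assms(3) by (simp add: d)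
  have mm: "m \<bullet> m > 0" using assms(5) by (simp add: m_def)
  \<comment> \<open>Cramer's rule in the basis \<open>a\<close>, \<open>b\<close>, \<open>m\<close>;
    the last coefficient vanishes.\<close>
  have "(m \<bullet> m) *\<^sub>R y = (cross3 y b \<bullet> m) *\<^sub>R a + (cross3 a y \<bullet> m) *\<^sub>R b + (m \<bullet> y) *\<^sub>R m"
    unfolding m_def by (simp add: cross3_def vec_eq_iff forall_3 inner_vec_def sum_3) algebra
  then have "inverse (m \<bullet> m) *\<^sub>R (m \<bullet> m) *\<^sub>R y
      = inverse (m \<bullet> m) *\<^sub>R ((cross3 y b \<bullet> m) *\<^sub>R a + (cross3 a y \<bullet> m) *\<^sub>R b)"
    using my by simp
  then have "y = (inverse (m \<bullet> m) * (cross3 y b \<bullet> m)) *\<^sub>R a + (inverse (m \<bullet> m) * (cross3 a y \<bullet> m)) *\<^sub>R b"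
    using mm by (simp add: scaleR_right_distrib)
  then show thesis using that by blast
qed

text \<open>All points of the curve lie in the span of its frame. Two of them not on a line through
  the centre give a linear system for \<open>n \<bullet> a\<close> and \<open>n \<bullet> b\<close>
  with determinant \<open>w X (k * q - k * p)\<close>, which is nonzero.\<close>

lemma geodesic_plane:
  assumes g: "geodesic X \<gamma>" and ne: "cross3 (\<gamma> p) (\<gamma> q) \<noteq> 0"
    and n: "n \<bullet> \<gamma> p = 0" "n \<bullet> \<gamma> q = 0"
  obtains a b c s k where "frame X a b" "\<gamma> = gcurve X a b c s k" "k \<noteq> 0" "n \<bullet> a = 0" "n \<bullet> b = 0"
proof -
  obtain a b c s k where fr: "frame X a b" and e: "\<gamma> = gcurve X a b c s k"
    using geodesic_gcurve[OF g] by metis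
  have wne: "w X (k * q - k * p) \<noteq> 0" using ne by (auto simp: e cross3_gcurve)
  have 1: "cosX X (k * p) * (n \<bullet> a) + w X (k * p) * (n \<bullet> b) = 0"
    "cosX X (k * q) * (n \<bullet> a) + w X (k * q) * (n \<bullet> b) = 0"
    using n by (simp_all add: e gcurve_def turn_def inner_simps)
  have "w X (k * q - k * p) * (n \<bullet> a) = 0" "w X (k * q - k * p) * (n \<bullet> b) = 0"
    using 1 unfolding w_diff by algebra+
  then have "n \<bullet> a = 0" "n \<bullet> b = 0" using wne by simp_all
  moreover have "k \<noteq> 0" using wne by auto
  ultimately show thesis using that fr e by blast
qed

lemma geodesic_in_plane:
  assumes "geodesic X \<gamma>" "cross3 (\<gamma> p) (\<gamma> q) \<noteq> 0" "n \<bullet> \<gamma> p = 0" "n \<bullet> \<gamma> q = 0"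
  shows "n \<bullet> \<gamma> t = 0"
proof -
  obtain a b c s k where "\<gamma> = gcurve X a b c s k" "n \<bullet> a = 0" "n \<bullet> b = 0"
    using geodesic_plane[OF assms] by metis
  then show ?thesis by (simp add: gcurve_def turn_def inner_simps)
qed

text \<open>As k is nonzero, the angle k t takes all real values, so radially the curve covers its
  whole great circle or hyperbolic line. A central projection thus catches every surface point of
  the plane.\<close>

lemma geodesic_cone:
  assumes g: "geodesic X \<gamma>" "cross3 (\<gamma> p) (\<gamma> q) \<noteq> 0" "n \<bullet> \<gamma> p = 0" "n \<bullet> \<gamma> q = 0"
    and n: "n \<noteq> 0" and y: "y \<in> points X" "n \<bullet> y = 0"
  obtains t r where "r > 0" "y = r *\<^sub>R \<gamma> t"
proof -
  obtain a b c s k where fr: "frame X a b" and e: "\<gamma> = gcurve X a b c s k" and k: "k \<noteq> 0"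
    and nab: "n \<bullet> a = 0" "n \<bullet> b = 0"
    using geodesic_plane[OF g] by metis
  define u where "u = unit X y"
  have u: "u \<in> unit_points X" using unit_in_unit_points[OF y(1)] by (simp add: u_def)
  have "n \<bullet> u = 0" using y(2) by (simp add: u_def unit_def)
  then obtain \<alpha> \<beta> where ab: "u = \<alpha> *\<^sub>R a + \<beta> *\<^sub>R b"
    using span2_normal[OF nab _ n frame_cross[OF fr]] by metis
  have "bil X u u = \<alpha>\<^sup>2 + eps X * \<beta>\<^sup>2"
    using frame_bil[OF fr] by (simp add: ab power2_eq_square)
  then have q: "\<alpha>\<^sup>2 + eps X * \<beta>\<^sup>2 = 1" using u by (simp add: unit_points_def)
  have "\<exists>\<theta>. cosX X \<theta> = \<alpha> \<and> w X \<theta> = \<beta>"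
  proof (cases X)
    case S2R
    then have "\<alpha>\<^sup>2 + \<beta>\<^sup>2 = 1" using q by (simp add: eps_def)
    then show ?thesis using sincos_total_2pi[of \<alpha> \<beta>] S2R by (metis cosX_def model.case(1) w.simps(1))
  next
    case H2R
    have "bil H2R a u > 0"
      using points_H2R_gram(3)[of a u] fr u H2R by (auto simp: frame_def unit_points_def)
    then have "\<alpha> > 0" using frame_bil[OF fr] H2R by (simp add: ab)
    moreover have "\<alpha>\<^sup>2 = \<beta>\<^sup>2 + 1" using q H2R by (simp add: eps_def)
    ultimately have "sqrt (\<beta>\<^sup>2 + 1) = \<alpha>" by (metis less_imp_le real_sqrt_unique)
    then show ?thesis using H2R by (intro exI[of _ "arsinh \<beta>"]) (simp add: cosX_def cosh_arsinh_real)
  qed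
  then obtain \<theta> where th: "cosX X \<theta> = \<alpha>" "w X \<theta> = \<beta>" by blast
  define t where "t = \<theta> / k"
  have "\<gamma> t = exp (c + s * t) *\<^sub>R u" using k th by (simp add: e gcurve_def turn_def t_def ab)
  moreover have "y = exp (height X y) *\<^sub>R u" using scale_unit[OF y(1)] by (simp add: u_def)
  ultimately have "y = (exp (height X y) / exp (c + s * t)) *\<^sub>R \<gamma> t" by simp
  then show thesis using that[of "exp (height X y) / exp (c + s * t)" t] by simp
qed

text \<open>With p, l the parameters of P, B, oddness of \<open>w\<close> absorbs the sign
  convention, and the ratio is \<open>w X (k * p) / w X (k * l - k * p)\<close> wherever P lies. The
  subtraction formula behind \<open>cross3_turn\<close> then gives the parallelism. The last claim,
  that the side is minimising, serves to place it in the surface.\<close>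

lemma side_ratio:
  assumes j: "joins X \<gamma> A B" and r: "ratio_defined X \<gamma> A P B"
  shows "cross3 P (unit X A + simply_ratio X \<gamma> A P B *\<^sub>R unit X B) = 0"
    and "cross3 P B \<noteq> 0"
    and "unit X A \<noteq> unit X B"
    and "\<exists>l>0. \<gamma> l = B \<and> (\<forall>s\<in>{0..l}. \<forall>t\<in>{0..l}. rho X (\<gamma> s) (\<gamma> t) = \<bar>s - t\<bar>)"
proof -
  define v k where "v = v_param X \<gamma>" and "k = cos v"
  have geo: "geodesic X \<gamma>" and A: "\<gamma> 0 = A" using j by (auto simp: joins_def)
  obtain l p where l: "l \<ge> 0" "\<gamma> l = B" and p: "\<gamma> p = P" and adm: "admissible_arc X \<gamma> l"
    "admissible_arc X \<gamma> p" "admissible_arc X \<gamma> (p - l)"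
    and ne: "\<not> fibre_like X \<gamma>" "A \<noteq> B" "w X (gdist X P B * k) \<noteq> 0"
    using r unfolding ratio_defined_def k_def v_def by blast
  have "has_param X \<gamma> v"
    using geo unfolding geodesic_def v_param_def v_def by (rule someI_ex)
  then have "- (pi/2) \<le> v" "v \<le> pi/2" by (simp_all add: has_param_def)
  moreover have "\<bar>v\<bar> \<noteq> pi/2" using ne(1) by (simp add: fibre_like_def v_def)
  ultimately have k: "k > 0" unfolding k_def by (intro cos_gt_zero_pi) auto
  obtain a b c s where fr: "frame X a b" and sk: "s\<^sup>2 + k\<^sup>2 = 1" and e: "\<gamma> = gcurve X a b c s k"
    using geodesic_gcurve[OF geo] unfolding k_def v_def by metis
  have kle: "X = S2R \<Longrightarrow> \<bar>k * x\<bar> \<le> pi" if "admissible_arc X \<gamma> x" for x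
    using that k unfolding admissible_arc_def v_def[symmetric] k_def[symmetric]
    by (simp add: abs_mult mult.commute)
  have dist: "rho X (\<gamma> x) (\<gamma> y) = \<bar>x - y\<bar>" if "X = S2R \<Longrightarrow> \<bar>k * (x - y)\<bar> \<le> pi" for x y
    using rho_gcurve[OF fr, of k x y c s] that sk by (simp add: e)
  have pts: "\<gamma> x \<in> points X" for x using geodesic_in_points[OF geo] .
  have inj: "x = y" if "\<gamma> x = \<gamma> y" "X = S2R \<Longrightarrow> \<bar>k * (x - y)\<bar> \<le> pi" for x y
    using dist[of x y] that rho_eq_0_iff[OF pts pts, of x y] by simp
  have dAP: "gdist X A P = \<bar>p\<bar>"
    using dist[of 0 p] kle[OF adm(2)] gdist_eq_rho[OF pts pts, of 0 p] by (simp add: A p)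
  have dPB: "gdist X P B = \<bar>p - l\<bar>"
    using dist[of p l] kle[OF adm(3)] gdist_eq_rho[OF pts pts, of p l] by (simp add: l p)
  have l0: "l > 0" using l A ne(2) by (cases "l = 0") auto
  have in_l: "\<bar>k * (x - y)\<bar> \<le> pi" if "x \<in> {0..l}" "y \<in> {0..l}" "X = S2R" for x y
  proof -
    have "\<bar>k * (x - y)\<bar> \<le> k * l" using that k by (auto simp: abs_mult intro!: mult_left_mono)
    then show ?thesis using kle[OF adm(1) that(3)] k l0 by simp
  qed
  show "\<exists>l>0. \<gamma> l = B \<and> (\<forall>s\<in>{0..l}. \<forall>t\<in>{0..l}. rho X (\<gamma> s) (\<gamma> t) = \<bar>s - t\<bar>)"
    using l0 l(2) in_l dist by (intro exI[of _ l]) auto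
  \<comment> \<open>A geodesic at constant height over the sphere is periodic, so the parameters of
    \<open>P\<close> and \<open>B\<close> must be shown unique among admissible arcs.\<close>
  have seg: "P \<in> geodesic_segment X \<gamma> B \<longleftrightarrow> 0 \<le> p \<and> p \<le> l"
  proof
    assume "P \<in> geodesic_segment X \<gamma> B"
    then obtain s' l' where s: "P = \<gamma> s'" "0 \<le> s'" "s' \<le> l'" "\<gamma> l' = B" "admissible_arc X \<gamma> l'"
      by (auto simp: geodesic_segment_def)
    have "l' = l"
    proof (rule inj)
      show "\<gamma> l' = \<gamma> l" using s l by simp
      assume X: "X = S2R"
      have "k * l' \<le> pi" "k * l \<le> pi" using kle[OF s(5) X] kle[OF adm(1) X] by (simp_all add: abs_le_iff)
      moreover have "0 \<le> k * l'" "0 \<le> k * l" using k s l0 by simp_all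
      ultimately show "\<bar>k * (l' - l)\<bar> \<le> pi" by (simp add: right_diff_distrib abs_le_iff)
    qed
    have "p = s'"
    proof (rule inj)
      show "\<gamma> p = \<gamma> s'" using s p by simp
      assume X: "X = S2R"
      have 1: "k * p \<le> pi" "k * l - k * p \<le> pi"
        using kle[OF adm(2) X] kle[OF adm(3) X] by (simp_all add: abs_le_iff right_diff_distrib)
      have "0 \<le> k * s'" "k * s' \<le> k * l" using k s \<open>l' = l\<close> by simp_all
      then show "\<bar>k * (p - s')\<bar> \<le> pi" using 1 by (simp add: right_diff_distrib abs_le_iff)
    qed
    then show "0 \<le> p \<and> p \<le> l" using s \<open>l' = l\<close> by simp
  next
    assume "0 \<le> p \<and> p \<le> l"
    then show "P \<in> geodesic_segment X \<gamma> B"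
      using p l(2) adm(1) by (auto simp: geodesic_segment_def)
  qed
  define \<sigma> where "\<sigma> = simply_ratio X \<gamma> A P B"
  have wne: "w X (k * l - k * p) \<noteq> 0"
  proof -
    have "w X (\<bar>p - l\<bar> * k) \<noteq> 0" using ne(3) dPB by simp
    moreover have "w X (\<bar>p - l\<bar> * k) = w X (k * l - k * p) \<or> w X (\<bar>p - l\<bar> * k) = - w X (k * l - k * p)"
      using w_minus[of X "k * l - k * p"] by (cases "p \<le> l") (simp_all add: algebra_simps)
    ultimately show ?thesis by auto
  qed
  \<comment> \<open>Before A the numerator changes sign, beyond B the denominator does; both agree
    with the minus sign of the outer ratio.\<close>
  have sig: "\<sigma> = w X (k * p) / w X (k * l - k * p)"
  proof -
    have m: "w X (k * p - k * l) = - w X (k * l - k * p)"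
      using w_minus[of X "k * l - k * p"] by simp
    consider "0 \<le> p \<and> p \<le> l" | "p < 0" | "p > l" by linarith
    then show ?thesis
    proof cases
      case 1
      then show ?thesis using seg
        by (simp add: \<sigma>_def simply_ratio_def dAP dPB algebra_simps flip: k_def v_def)
    next
      case 2
      then show ?thesis using seg l0
        by (simp add: \<sigma>_def simply_ratio_def dAP dPB algebra_simps flip: k_def v_def)
    next
      case 3
      then show ?thesis using seg l0 m
        by (simp add: \<sigma>_def simply_ratio_def dAP dPB algebra_simps flip: k_def v_def)
    qed
  qed
  have uA: "unit X A = turn X a b 0" and uB: "unit X B = turn X a b (k * l)"
    using unit_gcurve[OF fr, of c s k 0] unit_gcurve[OF fr, of c s k l] A l(2) by (simp_all add: e)
  have P: "P = exp (c + s * p) *\<^sub>R turn X a b (k * p)" using p by (simp add: e gcurve_def)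
  have "cross3 (turn X a b (k * p)) (turn X a b 0 + \<sigma> *\<^sub>R turn X a b (k * l))
      = (\<sigma> * w X (k * l - k * p) - w X (k * p)) *\<^sub>R cross3 a b"
    using cross3_turn[of X a b "k * p" 0] cross3_turn[of X a b "k * p" "k * l"]
    by (simp add: cross_add_right del: turn_0) (simp add: scaleR_left_diff_distrib)
  also have "\<dots> = 0" using wne by (simp add: sig)
  finally have "cross3 (turn X a b (k * p)) (unit X A + \<sigma> *\<^sub>R unit X B) = 0"
    unfolding uA uB .
  then have "cross3 P (unit X A + \<sigma> *\<^sub>R unit X B) = 0" by (subst P) (simp only: cross3_scale scaleR_zero_right)
  then show "cross3 P (unit X A + simply_ratio X \<gamma> A P B *\<^sub>R unit X B) = 0"
    by (simp only: \<sigma>_def)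
  show "cross3 P B \<noteq> 0"
    using wne frame_cross[OF fr] unfolding p[symmetric] l(2)[symmetric] e cross3_gcurve by simp
  have AB: "A \<in> points X" "B \<in> points X" using pts A l(2) by metis+
  have "ang X A B = k * l"
    using ang_gcurve[OF fr, of k 0 l c s] kle[OF adm(1)] A l k by (simp add: e abs_mult)
  then have "ang X A B \<noteq> 0" using k l0 by simp
  then show "unit X A \<noteq> unit X B" using ang_eq_0_iff[OF AB] by blast
qed

text \<open>Take the ratios of \<open>P\<close> itself. For a competitor with the same ratios the
  triangle inequality along the side becomes a comparison of single distances, so \<open>P\<close>
  is nearest to A0. Avoiding the vertices keeps both ratios positive and finite.\<close>

lemma between_in_surface:
  assumes pts: "A0 \<in> points X" "A1 \<in> points X" "A2 \<in> points X" "P \<in> points X"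
    and ne: "P \<noteq> A0" "P \<noteq> A1" "P \<noteq> A2"
    and btw: "rho X A0 P + rho X P A1 = rho X A0 A1 \<or> rho X A2 P + rho X P A0 = rho X A2 A0"
  shows "P \<in> triangle_surface X A0 A1 A2"
proof -
  have pos: "rho X A0 P > 0" "rho X P A1 > 0" "rho X A2 P > 0" "rho X P A0 > 0"
    using rho_eq_0_iff pts ne rho_nonneg by (metis less_eq_real_def)+
  define \<mu> \<nu> where "\<mu> = rho X A0 P / rho X P A1" and "\<nu> = rho X A2 P / rho X P A0"
  have mn: "\<mu> > 0" "\<nu> > 0" using pos by (simp_all add: \<mu>_def \<nu>_def)
  have rP: "rho X A0 P = \<mu> * rho X P A1" "rho X A2 P = \<nu> * rho X P A0"
    using pos by (simp_all add: \<mu>_def \<nu>_def)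
  have C: "apollonius_curve X A0 A1 A2 \<mu> \<nu>
      = {Q \<in> points X. rho X A0 Q = \<mu> * rho X Q A1 \<and> rho X A2 Q = \<nu> * rho X Q A0}"
    using mn pts by (auto simp: apollonius_curve_def apollonius_def gdist_eq_rho)
  have "rho X P A0 \<le> rho X Q A0" if Q: "Q \<in> points X" "rho X A0 Q = \<mu> * rho X Q A1"
    "rho X A2 Q = \<nu> * rho X Q A0" for Q
    using btw
  proof
    assume "rho X A0 P + rho X P A1 = rho X A0 A1"
    also have "\<dots> \<le> rho X A0 Q + rho X Q A1" by (rule rho_triangle[OF pts(1) Q(1) pts(2)])
    finally have "(\<mu> + 1) * rho X P A1 \<le> (\<mu> + 1) * rho X Q A1"
      using rP Q by (simp add: algebra_simps)
    then have "rho X P A1 \<le> rho X Q A1" using mn by simp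
    then have "rho X A0 P \<le> rho X A0 Q" using rP(1) Q(2) mn by simp
    then show ?thesis by (simp add: rho_commute[of X _ A0])
  next
    assume "rho X A2 P + rho X P A0 = rho X A2 A0"
    also have "\<dots> \<le> rho X A2 Q + rho X Q A0" by (rule rho_triangle[OF pts(3) Q(1) pts(1)])
    finally have "(\<nu> + 1) * rho X P A0 \<le> (\<nu> + 1) * rho X Q A0"
      using rP Q by (simp add: algebra_simps)
    then show ?thesis using mn by simp
  qed
  then have "P \<in> nearest_points X A0 A1 A2 \<mu> \<nu>"
    using rP pts by (auto simp: nearest_points_def C gdist_eq_rho)
  moreover have "\<mu>\<^sup>2 + \<nu>\<^sup>2 > 0" using mn by (simp add: add_pos_pos)
  ultimately show ?thesis using mn unfolding triangle_surface_def
    by (intro UN_I[of "(\<mu>, \<nu>)"]) auto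
qed

text \<open>When side and cevian span the same plane through the centre, the projected cevian
  contains every point of the side that is in \<open>S\<close>, hence an arc. \<open>Z\<close>
  stands for the opposite vertex, the only interior point of the side that may be missing.\<close>

lemma planar_overlap:
  assumes g: "geodesic X \<gamma>" and l: "l > 0"
    and dist: "\<And>s t. s \<in> {0..l} \<Longrightarrow> t \<in> {0..l} \<Longrightarrow> rho X (\<gamma> s) (\<gamma> t) = \<bar>s - t\<bar>"
    and plane: "\<And>t. n \<bullet> \<gamma> t = 0" and n: "n \<noteq> 0"
    and sub: "\<And>s. 0 < s \<Longrightarrow> s < l \<Longrightarrow> \<gamma> s \<noteq> Z \<Longrightarrow> \<gamma> s \<in> S"
    and h: "geodesic X h" "cross3 (h p) (h q) \<noteq> 0" "n \<bullet> h p = 0" "n \<bullet> h q = 0"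
    and meet: "meet_in (central_projection S (range h)) (range \<gamma>) R"
  shows False
proof -
  have pts: "\<gamma> x \<in> points X" for x using geodesic_in_points[OF g] .
  have inj: "x = y" if "\<gamma> x = \<gamma> y" "x \<in> {0..l}" "y \<in> {0..l}" for x y
    using dist[of x y] that rho_eq_0_iff[OF pts pts, of x y] by simp
  \<comment> \<open>By injectivity \<open>Z\<close> can lie on only one of two disjoint
    subarcs.\<close>
  have "\<exists>\<alpha> \<beta>. 0 < \<alpha> \<and> \<alpha> < \<beta> \<and> \<beta> < l \<and> Z \<notin> \<gamma> ` {\<alpha>..\<beta>}"
  proof (cases "Z \<in> \<gamma> ` {l/5..2*l/5}")
    case True
    then obtain z where z: "Z = \<gamma> z" "z \<in> {l/5..2*l/5}" by blast
    have "Z \<notin> \<gamma> ` {3*l/5..4*l/5}"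
    proof
      assume "Z \<in> \<gamma> ` {3*l/5..4*l/5}"
      then obtain z' where z': "Z = \<gamma> z'" "z' \<in> {3*l/5..4*l/5}" by blast
      have "z = z'" using z z' l by (intro inj) auto
      then show False using z z' l by auto
    qed
    then show ?thesis using l by (intro exI[of _ "3*l/5"] exI[of _ "4*l/5"]) auto
  next
    case False
    then show ?thesis using l by (intro exI[of _ "l/5"] exI[of _ "2*l/5"]) auto
  qed
  then obtain \<alpha> \<beta> where ab: "0 < \<alpha>" "\<alpha> < \<beta>" "\<beta> < l" "Z \<notin> \<gamma> ` {\<alpha>..\<beta>}" by blast
  define i where "i = (\<lambda>t. \<alpha> + (\<beta> - \<alpha>) * t)"
  have i: "i t \<in> {\<alpha>..\<beta>}" if "t \<in> {0..1}" for t
  proof -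
    have "0 \<le> (\<beta> - \<alpha>) * t" "(\<beta> - \<alpha>) * t \<le> (\<beta> - \<alpha>) * 1"
      using that ab(2) by (simp, intro mult_left_mono) auto
    then show ?thesis by (simp add: i_def)
  qed
  have "arc (\<gamma> \<circ> i)"
    unfolding arc_def path_def
  proof
    show "continuous_on {0..1} (\<gamma> \<circ> i)"
      using geodesic_continuous[OF g]
      by (intro continuous_on_compose) (auto simp: i_def intro!: continuous_intros)
    show "inj_on (\<gamma> \<circ> i) {0..1}"
    proof (rule inj_onI)
      fix x y assume xy: "x \<in> {0..1::real}" "y \<in> {0..1}" "(\<gamma> \<circ> i) x = (\<gamma> \<circ> i) y"
      have "i x = i y" using inj[of "i x" "i y"] xy i[OF xy(1)] i[OF xy(2)] ab by auto
      then show "x = y" using ab by (simp add: i_def)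
    qed
  qed
  moreover have "path_image (\<gamma> \<circ> i) \<subseteq> central_projection S (range h) \<inter> range \<gamma>"
  proof
    fix y assume "y \<in> path_image (\<gamma> \<circ> i)"
    then obtain t where t: "t \<in> {0..1}" "y = \<gamma> (i t)" by (auto simp: path_image_def)
    have "i t \<in> {\<alpha>..\<beta>}" by (rule i[OF t(1)])
    then have "y \<in> S" using sub[of "i t"] t(2) ab by force
    moreover obtain x r where "r > 0" "y = r *\<^sub>R h x"
      using geodesic_cone[OF h n, of y] pts plane t(2) by metis
    ultimately have "y \<in> central_projection S (range h)" by (auto simp: central_projection_def)
    then show "y \<in> central_projection S (range h) \<inter> range \<gamma>" using t(2) by blast
  qed
  ultimately show False using meet unfolding meet_in_def by blast
qed

lemma cross3_zeroE:
  assumes "cross3 p v = 0" "p \<noteq> 0"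
  obtains c where "v = c *\<^sub>R p"
proof -
  have "v = 0 \<or> (\<exists>c. v = c *\<^sub>R p)"
    using assms unfolding cross_eq_0 collinear_lemma by blast
  then show thesis using that[of 0] that by auto
qed

text \<open>C, T and P lie in a plane through the centre, so the determinant of C, T and a +
  \<sigma> b vanishes; it is expanded by linearity. If C and T are collinear with the centre, it
  vanishes trivially.\<close>

lemma cevian_relation:
  assumes h: "joins X h C T" and P: "P \<in> central_projection S (range h)" "P \<noteq> 0"
    and c: "cross3 P (a + \<sigma> *\<^sub>R b) = 0"
  shows "T \<bullet> cross3 (unit X C) a = \<sigma> * (T \<bullet> cross3 b (unit X C))"
proof -
  obtain l where t: "geodesic X h" "h 0 = C" "h l = T" using h by (auto simp: joins_def)
  obtain x r where x: "P = r *\<^sub>R h x" using P(1) by (auto simp: central_projection_def)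
  have "cross3 C T \<bullet> h x = 0"
  proof (cases "cross3 C T = 0")
    case False
    then show ?thesis
      using geodesic_in_plane[OF t(1), of 0 l "cross3 C T" x] t(2,3) dot_cross_self[of C T]
        dot_cross_self[of T C] by (simp add: inner_commute)
  qed simp
  moreover obtain y where "a + \<sigma> *\<^sub>R b = y *\<^sub>R P"
    using cross3_zeroE[OF c P(2)] by blast
  ultimately have "cross3 C T \<bullet> (a + \<sigma> *\<^sub>R b) = 0" by (simp add: x)
  moreover have "C \<in> points X" using geodesic_in_points[OF t(1), of 0] t by simp
  then have "C = exp (height X C) *\<^sub>R unit X C" by (rule scale_unit)
  ultimately have "exp (height X C) * (cross3 (unit X C) T \<bullet> (a + \<sigma> *\<^sub>R b)) = 0"
    by (metis cross3_scale(1) inner_scaleR_left)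
  then have "cross3 (unit X C) T \<bullet> (a + \<sigma> *\<^sub>R b) = 0" by simp
  then show ?thesis
    by (simp add: cross3_def inner_vec_def sum_3) algebra
qed

lemma cramer_cross3:
  "(a \<bullet> cross3 b c) *\<^sub>R x
    = (x \<bullet> cross3 b c) *\<^sub>R a + (x \<bullet> cross3 c a) *\<^sub>R b + (x \<bullet> cross3 a b) *\<^sub>R c"
  by (simp add: cross3_def vec_eq_iff forall_3 inner_vec_def sum_3) algebra

theorem theorem4p7:
  fixes X :: model
    and A0 A1 A2 T P Q R :: "real^3"
    and g01 g12 g20 h0 h1 h2 :: "real \<Rightarrow> real^3"
  defines "S \<equiv> triangle_surface X A0 A1 A2"
  assumes sides: "joins X g01 A0 A1" "joins X g12 A1 A2" "joins X g20 A2 A0"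
    and general: "general_type X A0 A1 A2"
    and T_in: "T \<in> S"
    and T_side: "T \<notin> geodesic_segment X g01 A1" "T \<notin> geodesic_segment X g12 A2"
      "T \<notin> geodesic_segment X g20 A0"
    and cevians: "joins X h0 A0 T" "joins X h1 A1 T" "joins X h2 A2 T"
    and Q: "meet_in (central_projection S (range h0)) (range g12) Q"
    and R: "meet_in (central_projection S (range h1)) (range g20) R"
    and P: "meet_in (central_projection S (range h2)) (range g01) P"
    and ratios: "ratio_defined X g01 A0 P A1" "ratio_defined X g12 A1 Q A2"
      "ratio_defined X g20 A2 R A0"
  shows "simply_ratio X g01 A0 P A1 * simply_ratio X g12 A1 Q A2 * simply_ratio X g20 A2 R A0 = 1"
proof -
  define a0 a1 a2 where "a0 = unit X A0" and "a1 = unit X A1" and "a2 = unit X A2"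
  define \<sigma>0 \<sigma>1 \<sigma>2 where "\<sigma>0 = simply_ratio X g01 A0 P A1"
    and "\<sigma>1 = simply_ratio X g12 A1 Q A2" and "\<sigma>2 = simply_ratio X g20 A2 R A0"
  note s01 = side_ratio[OF sides(1) ratios(1), folded a0_def a1_def \<sigma>0_def]
  note s12 = side_ratio[OF sides(2) ratios(2), folded a1_def a2_def \<sigma>1_def]
  note s20 = side_ratio[OF sides(3) ratios(3), folded a2_def a0_def \<sigma>2_def]
  have g: "geodesic X g01" "g01 0 = A0" "geodesic X g12" "g12 0 = A1" "geodesic X g20" "g20 0 = A2"
    using sides by (simp_all add: joins_def)
  have pts: "A0 \<in> points X" "A1 \<in> points X" "A2 \<in> points X"
    using geodesic_in_points[OF g(1), of 0] geodesic_in_points[OF g(3), of 0]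
      geodesic_in_points[OF g(5), of 0] g by simp_all
  obtain l0 l1 l2 where h: "geodesic X h0" "h0 0 = A0" "h0 l0 = T" "geodesic X h1" "h1 0 = A1" "h1 l1 = T"
    "geodesic X h2" "h2 0 = A2" "h2 l2 = T"
    using cevians by (auto simp: joins_def)
  have T: "T \<in> points X" using geodesic_in_points[OF h(1), of l0] h by simp
  have u: "a0 \<in> unit_points X" "a1 \<in> unit_points X" "a2 \<in> unit_points X"
    unfolding a0_def a1_def a2_def using pts unit_in_unit_points by blast+
  obtain r0 r1 r2 where A: "A0 = r0 *\<^sub>R a0" "A1 = r1 *\<^sub>R a1" "A2 = r2 *\<^sub>R a2"
    using scale_unit pts unfolding a0_def a1_def a2_def by metis
  have PQR: "P \<noteq> 0" "Q \<noteq> 0" "R \<noteq> 0" using s01(2) s12(2) s20(2) by auto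
  define t0 t1 t2 where "t0 = T \<bullet> cross3 a1 a2" and "t1 = T \<bullet> cross3 a2 a0" and "t2 = T \<bullet> cross3 a0 a1"
  have PC: "P \<in> central_projection S (range h2)" and QC: "Q \<in> central_projection S (range h0)"
    and RC: "R \<in> central_projection S (range h1)" and Pg: "P \<in> range g01" and Rg: "R \<in> range g20"
    using P Q R by (auto simp: meet_in_def)
  have t1: "t1 = \<sigma>0 * t0"
    using cevian_relation[OF cevians(3) PC PQR(1) s01(1)] by (simp add: t0_def t1_def a2_def)
  have t2: "t2 = \<sigma>1 * t1"
    using cevian_relation[OF cevians(1) QC PQR(2) s12(1)] by (simp add: t1_def t2_def a0_def)
  have t0: "t0 = \<sigma>2 * t2"
    using cevian_relation[OF cevians(2) RC PQR(3) s20(1)] by (simp add: t2_def t0_def a1_def)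
  have "\<sigma>0 * \<sigma>1 * \<sigma>2 = 1"
  proof (cases "t0 = 0")
    case False
    have "\<sigma>2 * (\<sigma>1 * (\<sigma>0 * t0)) = t0" by (simp flip: t0 t1 t2)
    then have "(\<sigma>0 * \<sigma>1 * \<sigma>2) * t0 = 1 * t0" by (simp add: mult_ac)
    then show ?thesis using mult_right_cancel[OF False] by blast
  next
    case True
    then have zero: "t0 = 0" "t1 = 0" "t2 = 0" using t1 t2 by simp_all
    have "(a0 \<bullet> cross3 a1 a2) *\<^sub>R T = 0"
      using cramer_cross3[of a0 a1 a2 T] zero by (simp add: t0_def t1_def t2_def)
    then have D: "a0 \<bullet> cross3 a1 a2 = 0" using points_nonzero[OF T] by simp
    have "\<exists>n. n \<noteq> 0 \<and> n \<bullet> T = 0 \<and> n \<bullet> a0 = 0 \<and> n \<bullet> a1 = 0 \<and> n \<bullet> a2 = 0"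
    proof -
      have D': "a1 \<bullet> cross3 a2 a0 = 0" "a2 \<bullet> cross3 a0 a1 = 0"
        using D by (simp_all add: cross3_def inner_vec_def sum_3 algebra_simps)
      \<comment> \<open>Some two vertices span a plane: otherwise consecutive ones are antipodal,
        and going round an odd cycle gives a2 = a0. The nonzero cross product is the normal
        \<open>n\<close>.\<close>
      have "cross3 a1 a2 \<noteq> 0 \<or> cross3 a2 a0 \<noteq> 0 \<or> cross3 a0 a1 \<noteq> 0"
      proof (rule ccontr)
        assume "\<not> ?thesis"
        then have "a1 = - a0" "a2 = - a1"
          using cross3_unit_zero[OF u(1,2)] cross3_unit_zero[OF u(2,3)] s01(3) s12(3) by auto
        then show False using s20(3) by simp
      qed
      then show ?thesis
        using zero D D' unfolding t0_def t1_def t2_def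
        by (metis dot_cross_self inner_commute)
    qed
    then obtain n where n: "n \<noteq> 0" "n \<bullet> T = 0" "n \<bullet> a0 = 0" "n \<bullet> a1 = 0" "n \<bullet> a2 = 0" by blast
    then have nA: "n \<bullet> A0 = 0" "n \<bullet> A1 = 0" "n \<bullet> A2 = 0" by (simp_all add: A)
    obtain m01 where m01: "m01 > 0" "g01 m01 = A1"
      "\<And>s t. s \<in> {0..m01} \<Longrightarrow> t \<in> {0..m01} \<Longrightarrow> rho X (g01 s) (g01 t) = \<bar>s - t\<bar>"
      using s01(4) by blast
    obtain m20 where m20: "m20 > 0" "g20 m20 = A0"
      "\<And>s t. s \<in> {0..m20} \<Longrightarrow> t \<in> {0..m20} \<Longrightarrow> rho X (g20 s) (g20 t) = \<bar>s - t\<bar>"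
      using s20(4) by blast
    have sub01: "g01 s \<in> S" if s: "0 < s" "s < m01" and ne: "g01 s \<noteq> A2" for s
    proof -
      have p: "g01 s \<in> points X" using geodesic_in_points[OF g(1)] .
      have d: "rho X A0 (g01 s) = s" "rho X (g01 s) A1 = m01 - s" "rho X A0 A1 = m01"
        using m01(3)[of 0 s] m01(3)[of s m01] m01(3)[of 0 m01] m01(1,2) g(2) s by auto
      moreover have "g01 s \<noteq> A0" "g01 s \<noteq> A1" using d s rho_eq_0_iff p pts by fastforce+
      ultimately show ?thesis unfolding S_def using p pts ne by (intro between_in_surface) auto
    qed
    have sub20: "g20 s \<in> S" if s: "0 < s" "s < m20" and ne: "g20 s \<noteq> A1" for s
    proof -
      have p: "g20 s \<in> points X" using geodesic_in_points[OF g(5)] .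
      have d: "rho X A2 (g20 s) = s" "rho X (g20 s) A0 = m20 - s" "rho X A2 A0 = m20"
        using m20(3)[of 0 s] m20(3)[of s m20] m20(3)[of 0 m20] m20(1,2) g(6) s by auto
      moreover have "g20 s \<noteq> A0" "g20 s \<noteq> A2" using d s rho_eq_0_iff p pts by fastforce+
      ultimately show ?thesis unfolding S_def using p pts ne by (intro between_in_surface) auto
    qed
    \<comment> \<open>If the cevian from A2 spans the common plane, then P and with it the side A0A1
      lie there too, and the two overlap. \<open>no1\<close> treats the cevian from A1 and the side
      A2A0 alike.\<close>
    have no2: False if x: "cross3 A2 (h2 x) \<noteq> 0" "n \<bullet> h2 x = 0" for x
    proof -
      obtain y r where y: "P = r *\<^sub>R h2 y" using PC by (auto simp: central_projection_def)
      have "n \<bullet> h2 y = 0"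
        using geodesic_in_plane[OF h(7), of 0 x n y] x h(8) nA by simp
      then have nP: "n \<bullet> P = 0" by (simp add: y)
      obtain p where p: "P = g01 p" using Pg by blast
      have pl: "n \<bullet> g01 t = 0" for t
        using geodesic_in_plane[OF g(1), of p m01 n t] s01(2) p m01(2) nP nA by simp
      show False
      proof (rule planar_overlap[OF g(1) m01(1,3) pl n(1) _ h(7) _ _ _ P])
        show "g01 s \<in> S" if "0 < s" "s < m01" "g01 s \<noteq> A2" for s using sub01 that .
        show "cross3 (h2 0) (h2 x) \<noteq> 0" "n \<bullet> h2 0 = 0" "n \<bullet> h2 x = 0" using x h(8) nA by simp_all
      qed
    qed
    have no1: False if x: "cross3 A1 (h1 x) \<noteq> 0" "n \<bullet> h1 x = 0" for x
    proof -
      obtain y r where y: "R = r *\<^sub>R h1 y" using RC by (auto simp: central_projection_def)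
      have "n \<bullet> h1 y = 0"
        using geodesic_in_plane[OF h(4), of 0 x n y] x h(5) nA by simp
      then have nR: "n \<bullet> R = 0" by (simp add: y)
      obtain p where p: "R = g20 p" using Rg by blast
      have pl: "n \<bullet> g20 t = 0" for t
        using geodesic_in_plane[OF g(5), of p m20 n t] s20(2) p m20(2) nR nA by simp
      show False
      proof (rule planar_overlap[OF g(5) m20(1,3) pl n(1) _ h(4) _ _ _ R])
        show "g20 s \<in> S" if "0 < s" "s < m20" "g20 s \<noteq> A1" for s using sub20 that .
        show "cross3 (h1 0) (h1 x) \<noteq> 0" "n \<bullet> h1 0 = 0" "n \<bullet> h1 x = 0" using x h(5) nA by simp_all
      qed
    qed
    \<comment> \<open>T itself is in the plane, so it can only be collinear with the centre and A1,
      and likewise with A2. Thus A1 and A2 lie over antipodal points.\<close>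
    have c1: "cross3 A1 T = 0" using no1[of l1] h(6) n(2) by blast
    have c2: "cross3 A2 T = 0" using no2[of l2] h(9) n(2) by blast
    obtain d1 where d: "T = d1 *\<^sub>R A1"
      using cross3_zeroE[OF c1 points_nonzero[OF pts(2)]] by blast
    have "d1 \<noteq> 0" using d points_nonzero[OF T] by auto
    have "d1 *\<^sub>R cross3 A1 A2 = cross3 T A2" by (simp add: d)
    also have "\<dots> = 0" using c2 cross_skew[of T A2] by simp
    finally have "cross3 A1 A2 = 0" using \<open>d1 \<noteq> 0\<close> by simp
    moreover have "r1 \<noteq> 0" "r2 \<noteq> 0" using A points_nonzero pts by force+
    ultimately have "cross3 a1 a2 = 0" by (simp add: A)
    then have a21: "a2 = - a1" using cross3_unit_zero[OF u(2,3)] s12(3) by auto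
    have "cross3 a0 a1 \<noteq> 0"
      using cross3_unit_zero[OF u(1,2)] s01(3) s20(3) a21 by auto
    moreover have "r0 \<noteq> 0" using A points_nonzero pts by force
    ultimately have "cross3 A0 A1 \<noteq> 0" using \<open>r1 \<noteq> 0\<close> by (simp add: A)
    then have "n \<bullet> g01 t = 0" for t
      using geodesic_in_plane[OF g(1), of 0 m01 n t] g(2) m01(2) nA by simp
    then have nP: "n \<bullet> P = 0" using Pg by blast
    obtain y r where y: "P = r *\<^sub>R h2 y" "r > 0" using PC by (auto simp: central_projection_def)
    \<comment> \<open>P is on the plane and on the projected cevian from A2. As it is not collinear
      with A1, it is not collinear with the antipodal A2 either, so \<open>no2\<close> applies at
      \<open>y\<close> instead of at T.\<close>
    have "cross3 A2 (h2 y) \<noteq> 0"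
    proof
      assume "cross3 A2 (h2 y) = 0"
      then have "cross3 A2 P = 0" by (simp add: y(1))
      then have "cross3 a1 P = 0" using \<open>r2 \<noteq> 0\<close> a21 by (simp add: A)
      then show False using s01(2) cross_skew[of P A1] by (simp add: A)
    qed
    moreover have "n \<bullet> h2 y = 0" using nP y by simp
    ultimately show ?thesis using no2 by blast
  qed
  then show ?thesis by (simp add: \<sigma>0_def \<sigma>1_def \<sigma>2_def)
qed

end
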